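(* Let $(G,P)$ be a quasi-lattice ordered group, and let $\Lambda$ be a finitely aligned $P$-graph. Let $\tau$ be a representation of $\Lambda *_{d,s}\Lambda$ such that each $\tau_{\mu,\mu}$ ($\mu\in\Lambda$) is nonzero, and let $\rho_\tau : \mathcal{B}_\Lambda \to C^*(\tau)$ be the homomorphism induced by the universal property of $\mathcal{B}_\Lambda$, so $\rho_\tau(\omega_{\mu,\nu})=\tau_{\mu,\nu}$. Then $\ker(\rho_\tau)$ is generated (as a closed two-sided ideal) by the set $$\bigcup_{\mu \in \Lambda} \Big\{ \prod_{\alpha \in E} (\omega_{\mu,\mu} - \omega_{\mu\alpha,\mu\alpha}) : E \subset s(\mu)\Lambda\text{ is finite exhaustive and } \prod_{\alpha \in E} (\tau_{\mu,\mu} - \tau_{\mu\alpha,\mu\alpha}) = 0 \Big\}.$$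
   Context: A quasi-lattice ordered group $(G,P)$ is a discrete group $G$ with a subsemigroup $P$ such that $P\cap P^{-1}=\{e\}$ and, under the partial order $p\le q \Leftrightarrow p^{-1}q\in P$ on $G$, every pair $p,q\in G$ with a common upper bound in $P$ has a least common upper bound $p\vee q$ in $P$. Write $p\vee q=\infty$ if $p,q$ have no common upper bound in $P$, and $p\vee q<\infty$ otherwise. A $P$-graph is a countable category $\Lambda$ (its elements are its morphisms) with a functor $d:\Lambda\to P$ satisfying the factorisation property: whenever $d(\lambda)=pq$ with $p,q\in P$ there are unique $\mu,\nu\in\Lambda$ with $\lambda=\mu\nu$, $d(\mu)=p$, $d(\nu)=q$. For $p\in P$, $\Lambda^p:=d^{-1}(p)$; $\Lambda^0:=d^{-1}(e)$ is the set of identity morphisms (vertices); $r(\lambda),s(\lambda)\in\Lambda^0$ are the identity morphisms at the codomain and domain of $\lambda$. For $E\subset\Lambda$ and $v\in\Lambda^0$, $vE:=\{\mu\in E:r(\mu)=v\}$. For $\mu,\nu\in\Lambda$, $\mathrm{MCE}(\mu,\nu)$ is the set of $\lambda\in\Lambda$ with $d(\mu)\vee d(\nu)<\infty$, $d(\lambda)=d(\mu)\vee d(\nu)$ and $\lambda=\mu\alpha=\nu\beta$ for some $\alpha,\beta\in\Lambda$ (so it is empty if $d(\mu)\vee d(\nu)=\infty$). $\Lambda$ is finitely aligned if every $\mathrm{MCE}(\mu,\nu)$ is finite (possibly empty). For $v\in\Lambda^0$, $E\subset v\Lambda$ is exhaustive if for every $\mu\in v\Lambda$ there is $\lambda\in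 E$ with $\mathrm{MCE}(\mu,\lambda)\neq\emptyset$. $\Lambda*_{d,s}\Lambda:=\{(\mu,\nu)\in\Lambda\times\Lambda:s(\mu)=s(\nu),\ d(\mu)=d(\nu)\}$. A representation of $\Lambda*_{d,s}\Lambda$ in a $C^*$-algebra $B$ is a map $\tau:\Lambda*_{d,s}\Lambda\to B$, $(\mu,\nu)\mapsto\tau_{\mu,\nu}$, such that for all $(\mu,\nu),(\xi,\eta)$: (B1) $\tau_{\mu,\nu}^*=\tau_{\nu,\mu}$; (B2) $\tau_{\mu,\nu}\tau_{\xi,\eta}=\sum_{\nu\alpha=\xi\beta\in\mathrm{MCE}(\nu,\xi)}\tau_{\mu\alpha,\eta\beta}$. $C^*(\tau)$ is the $C^*$-subalgebra of $B$ generated by the $\tau_{\mu,\nu}$. The $\tau_{\mu,\mu}$ are then pairwise commuting projections. $\mathcal{B}_\Lambda$ is the universal $C^*$-algebra generated by a representation $\omega$ of $\Lambda*_{d,s}\Lambda$: for every representation $\tau$ there is a homomorphism $\rho_\tau:\mathcal{B}_\Lambda\to C^*(\tau)$ with $\rho_\tau\circ\omega=\tau$. *)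

theory Defs
  imports "HOL-Analysis.Analysis" "HOL-Algebra.Ring"
begin

section \<open>Quasi-lattice ordered groups\<close>

locale quasi_lattice_ordered_group = group G for G (structure) and P :: "'g set" +
  assumes P_subset: "P \<subseteq> carrier G"
    and P_mult_closed: "\<lbrakk>p \<in> P; q \<in> P\<rbrakk> \<Longrightarrow> p \<otimes> q \<in> P"
    and P_Int_inverse: "P \<inter> (\<lambda>p. inv p) ` P = {\<one>}"
    and ex_least_upper_bound:
      "\<lbrakk>p \<in> carrier G; q \<in> carrier G; u \<in> P; inv p \<otimes> u \<in> P; inv q \<otimes> u \<in> P\<rbrakk> \<Longrightarrow>
        \<exists>m\<in>P. inv p \<otimes> m \<in> P \<and> inv q \<otimes> m \<in> P \<and>
          (\<forall>w\<in>P. inv p \<otimes> w \<in> P \<and> inv q \<otimes> w \<in> P \<longrightarrow> inv m \<otimes> w \<in> P)"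

definition qlo_le :: "('g, 'x) monoid_scheme \<Rightarrow> 'g set \<Rightarrow> 'g \<Rightarrow> 'g \<Rightarrow> bool" where
  "qlo_le G P p q \<longleftrightarrow> inv\<^bsub>G\<^esub> p \<otimes>\<^bsub>G\<^esub> q \<in> P"

definition has_upper_bound :: "('g, 'x) monoid_scheme \<Rightarrow> 'g set \<Rightarrow> 'g \<Rightarrow> 'g \<Rightarrow> bool" where
  "has_upper_bound G P p q \<longleftrightarrow> (\<exists>u\<in>P. qlo_le G P p u \<and> qlo_le G P q u)"

text \<open>Only meaningful when \<open>has_upper_bound G P p q\<close>, i.e. when the join is finite.\<close>
definition qlo_join :: "('g, 'x) monoid_scheme \<Rightarrow> 'g set \<Rightarrow> 'g \<Rightarrow> 'g \<Rightarrow> 'g" where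
  "qlo_join G P p q = (THE m. m \<in> P \<and> qlo_le G P p m \<and> qlo_le G P q m \<and>
     (\<forall>w\<in>P. qlo_le G P p w \<and> qlo_le G P q w \<longrightarrow> qlo_le G P m w))"


section \<open>\<open>P\<close>-graphs\<close>

text \<open>
  A category is presented by its morphisms; \<open>rng\<close> and \<open>src\<close> send a morphism to the identity
  morphism at its codomain and domain, and \<open>cmp x y\<close> is the composite \<open>xy\<close>, which is meaningful
  when \<open>src x = rng y\<close>.
\<close>
record ('m, 'g) graph_data =
  Mor :: "'m set"
  rng :: "'m \<Rightarrow> 'm"
  src :: "'m \<Rightarrow> 'm"
  cmp :: "'m \<Rightarrow> 'm \<Rightarrow> 'm"
  deg :: "'m \<Rightarrow> 'g"

locale P_graph = quasi_lattice_ordered_group G P for G (structure) and P :: "'g set" +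
  fixes \<Lambda> :: "('m, 'g) graph_data"
  assumes countable_Mor: "countable (Mor \<Lambda>)"
    and rng_closed: "x \<in> Mor \<Lambda> \<Longrightarrow> rng \<Lambda> x \<in> Mor \<Lambda>"
    and src_closed: "x \<in> Mor \<Lambda> \<Longrightarrow> src \<Lambda> x \<in> Mor \<Lambda>"
    and rng_rng: "x \<in> Mor \<Lambda> \<Longrightarrow> rng \<Lambda> (rng \<Lambda> x) = rng \<Lambda> x"
    and src_rng: "x \<in> Mor \<Lambda> \<Longrightarrow> src \<Lambda> (rng \<Lambda> x) = rng \<Lambda> x"
    and rng_src: "x \<in> Mor \<Lambda> \<Longrightarrow> rng \<Lambda> (src \<Lambda> x) = src \<Lambda> x"
    and src_src: "x \<in> Mor \<Lambda> \<Longrightarrow> src \<Lambda> (src \<Lambda> x) = src \<Lambda> x"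
    and cmp_closed:
      "\<lbrakk>x \<in> Mor \<Lambda>; y \<in> Mor \<Lambda>; src \<Lambda> x = rng \<Lambda> y\<rbrakk> \<Longrightarrow> cmp \<Lambda> x y \<in> Mor \<Lambda>"
    and rng_cmp:
      "\<lbrakk>x \<in> Mor \<Lambda>; y \<in> Mor \<Lambda>; src \<Lambda> x = rng \<Lambda> y\<rbrakk> \<Longrightarrow> rng \<Lambda> (cmp \<Lambda> x y) = rng \<Lambda> x"
    and src_cmp:
      "\<lbrakk>x \<in> Mor \<Lambda>; y \<in> Mor \<Lambda>; src \<Lambda> x = rng \<Lambda> y\<rbrakk> \<Longrightarrow> src \<Lambda> (cmp \<Lambda> x y) = src \<Lambda> y"
    and cmp_assoc:
      "\<lbrakk>x \<in> Mor \<Lambda>; y \<in> Mor \<Lambda>; z \<in> Mor \<Lambda>; src \<Lambda> x = rng \<Lambda> y; src \<Lambda> y = rng \<Lambda> z\<rbrakk> \<Longrightarrow>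
        cmp \<Lambda> (cmp \<Lambda> x y) z = cmp \<Lambda> x (cmp \<Lambda> y z)"
    and cmp_rng: "x \<in> Mor \<Lambda> \<Longrightarrow> cmp \<Lambda> (rng \<Lambda> x) x = x"
    and cmp_src: "x \<in> Mor \<Lambda> \<Longrightarrow> cmp \<Lambda> x (src \<Lambda> x) = x"
    and deg_closed: "x \<in> Mor \<Lambda> \<Longrightarrow> deg \<Lambda> x \<in> P"
    and deg_rng: "x \<in> Mor \<Lambda> \<Longrightarrow> deg \<Lambda> (rng \<Lambda> x) = \<one>"
    and deg_cmp:
      "\<lbrakk>x \<in> Mor \<Lambda>; y \<in> Mor \<Lambda>; src \<Lambda> x = rng \<Lambda> y\<rbrakk> \<Longrightarrow> deg \<Lambda> (cmp \<Lambda> x y) = deg \<Lambda> x \<otimes> deg \<Lambda> y"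
    and factorisation:
      "\<lbrakk>x \<in> Mor \<Lambda>; p \<in> P; q \<in> P; deg \<Lambda> x = p \<otimes> q\<rbrakk> \<Longrightarrow>
        \<exists>!f. fst f \<in> Mor \<Lambda> \<and> snd f \<in> Mor \<Lambda> \<and> src \<Lambda> (fst f) = rng \<Lambda> (snd f) \<and>
          x = cmp \<Lambda> (fst f) (snd f) \<and> deg \<Lambda> (fst f) = p \<and> deg \<Lambda> (snd f) = q"

text \<open>The set \<open>v\<Lambda>\<close>.\<close>
definition paths_to :: "('m, 'g) graph_data \<Rightarrow> 'm \<Rightarrow> 'm set" where
  "paths_to \<Lambda> v = {x \<in> Mor \<Lambda>. rng \<Lambda> x = v}"

definition MCE ::
  "('g, 'x) monoid_scheme \<Rightarrow> 'g set \<Rightarrow> ('m, 'g) graph_data \<Rightarrow> 'm \<Rightarrow> 'm \<Rightarrow> 'm set" where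
  "MCE G P \<Lambda> \<mu> \<nu> = {x \<in> Mor \<Lambda>.
     has_upper_bound G P (deg \<Lambda> \<mu>) (deg \<Lambda> \<nu>) \<and>
     deg \<Lambda> x = qlo_join G P (deg \<Lambda> \<mu>) (deg \<Lambda> \<nu>) \<and>
     (\<exists>\<alpha>\<in>paths_to \<Lambda> (src \<Lambda> \<mu>). x = cmp \<Lambda> \<mu> \<alpha>) \<and>
     (\<exists>\<beta>\<in>paths_to \<Lambda> (src \<Lambda> \<nu>). x = cmp \<Lambda> \<nu> \<beta>)}"

definition finitely_aligned ::
  "('g, 'x) monoid_scheme \<Rightarrow> 'g set \<Rightarrow> ('m, 'g) graph_data \<Rightarrow> bool" where
  "finitely_aligned G P \<Lambda> \<longleftrightarrow> (\<forall>\<mu>\<in>Mor \<Lambda>. \<forall>\<nu>\<in>Mor \<Lambda>. finite (MCE G P \<Lambda> \<mu> \<nu>))"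

definition exhaustive ::
  "('g, 'x) monoid_scheme \<Rightarrow> 'g set \<Rightarrow> ('m, 'g) graph_data \<Rightarrow> 'm \<Rightarrow> 'm set \<Rightarrow> bool" where
  "exhaustive G P \<Lambda> v E \<longleftrightarrow> E \<subseteq> paths_to \<Lambda> v \<and>
     (\<forall>\<mu>\<in>paths_to \<Lambda> v. \<exists>x\<in>E. MCE G P \<Lambda> \<mu> x \<noteq> {})"

text \<open>The set \<open>\<Lambda> *\<^sub>d\<^sub>,\<^sub>s \<Lambda>\<close>.\<close>
definition ds_pairs :: "('m, 'g) graph_data \<Rightarrow> ('m \<times> 'm) set" where
  "ds_pairs \<Lambda> = {(\<mu>, \<nu>). \<mu> \<in> Mor \<Lambda> \<and> \<nu> \<in> Mor \<Lambda> \<and> src \<Lambda> \<mu> = src \<Lambda> \<nu> \<and> deg \<Lambda> \<mu> = deg \<Lambda> \<nu>}"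


section \<open>C*-algebras\<close>

text \<open>
  C*-algebras occur in two guises: structures on a carrier set, and types of the class
  \<open>cstar_algebra\<close> below.  The former are needed for subalgebras and to quantify over all target
  algebras in a universal property, the latter give access to the library on normed spaces.
  C*-algebras need not be unital: the field \<open>one\<close> inherited from \<open>ring\<close> is never used.
\<close>
record 'a cstar_structure = "'a ring" +
  cscale :: "complex \<Rightarrow> 'a \<Rightarrow> 'a"
  cadj :: "'a \<Rightarrow> 'a"
  cnrm :: "'a \<Rightarrow> real"

locale cstar_structure = abelian_group A for A :: "'a cstar_structure" (structure) +
  assumes mult_closed: "\<lbrakk>x \<in> carrier A; y \<in> carrier A\<rbrakk> \<Longrightarrow> x \<otimes> y \<in> carrier A"
    and mult_assoc:
      "\<lbrakk>x \<in> carrier A; y \<in> carrier A; z \<in> carrier A\<rbrakk> \<Longrightarrow> (x \<otimes> y) \<otimes> z = x \<otimes> (y \<otimes> z)"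
    and l_distr:
      "\<lbrakk>x \<in> carrier A; y \<in> carrier A; z \<in> carrier A\<rbrakk> \<Longrightarrow> (x \<oplus> y) \<otimes> z = x \<otimes> z \<oplus> y \<otimes> z"
    and r_distr:
      "\<lbrakk>x \<in> carrier A; y \<in> carrier A; z \<in> carrier A\<rbrakk> \<Longrightarrow> z \<otimes> (x \<oplus> y) = z \<otimes> x \<oplus> z \<otimes> y"
    and cscale_closed: "x \<in> carrier A \<Longrightarrow> cscale A c x \<in> carrier A"
    and cscale_add_right:
      "\<lbrakk>x \<in> carrier A; y \<in> carrier A\<rbrakk> \<Longrightarrow> cscale A c (x \<oplus> y) = cscale A c x \<oplus> cscale A c y"
    and cscale_add_left:
      "x \<in> carrier A \<Longrightarrow> cscale A (b + c) x = cscale A b x \<oplus> cscale A c x"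
    and cscale_cscale: "x \<in> carrier A \<Longrightarrow> cscale A b (cscale A c x) = cscale A (b * c) x"
    and cscale_one: "x \<in> carrier A \<Longrightarrow> cscale A 1 x = x"
    and cscale_mult_left:
      "\<lbrakk>x \<in> carrier A; y \<in> carrier A\<rbrakk> \<Longrightarrow> cscale A c x \<otimes> y = cscale A c (x \<otimes> y)"
    and cscale_mult_right:
      "\<lbrakk>x \<in> carrier A; y \<in> carrier A\<rbrakk> \<Longrightarrow> x \<otimes> cscale A c y = cscale A c (x \<otimes> y)"
    and cadj_closed: "x \<in> carrier A \<Longrightarrow> cadj A x \<in> carrier A"
    and cadj_cadj: "x \<in> carrier A \<Longrightarrow> cadj A (cadj A x) = x"
    and cadj_add: "\<lbrakk>x \<in> carrier A; y \<in> carrier A\<rbrakk> \<Longrightarrow> cadj A (x \<oplus> y) = cadj A x \<oplus> cadj A y"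
    and cadj_mult: "\<lbrakk>x \<in> carrier A; y \<in> carrier A\<rbrakk> \<Longrightarrow> cadj A (x \<otimes> y) = cadj A y \<otimes> cadj A x"
    and cadj_cscale: "x \<in> carrier A \<Longrightarrow> cadj A (cscale A c x) = cscale A (cnj c) (cadj A x)"
    and cnrm_nonneg: "x \<in> carrier A \<Longrightarrow> 0 \<le> cnrm A x"
    and cnrm_eq_0_iff: "x \<in> carrier A \<Longrightarrow> cnrm A x = 0 \<longleftrightarrow> x = \<zero>"
    and cnrm_triangle: "\<lbrakk>x \<in> carrier A; y \<in> carrier A\<rbrakk> \<Longrightarrow> cnrm A (x \<oplus> y) \<le> cnrm A x + cnrm A y"
    and cnrm_cscale: "x \<in> carrier A \<Longrightarrow> cnrm A (cscale A c x) = norm c * cnrm A x"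
    and cnrm_mult: "\<lbrakk>x \<in> carrier A; y \<in> carrier A\<rbrakk> \<Longrightarrow> cnrm A (x \<otimes> y) \<le> cnrm A x * cnrm A y"
    and cstar_identity: "x \<in> carrier A \<Longrightarrow> cnrm A (cadj A x \<otimes> x) = (cnrm A x)\<^sup>2"
    and complete:
      "\<lbrakk>\<And>n. f n \<in> carrier A; \<forall>e>0. \<exists>N. \<forall>m\<ge>N. \<forall>n\<ge>N. cnrm A (f m \<ominus> f n) < e\<rbrakk> \<Longrightarrow>
        \<exists>x\<in>carrier A. (\<lambda>n. cnrm A (f n \<ominus> x)) \<longlonglongrightarrow> 0"

definition cstar_subalgebra :: "'a cstar_structure \<Rightarrow> 'a set \<Rightarrow> bool" where
  "cstar_subalgebra A S \<longleftrightarrow> S \<subseteq> carrier A \<and> \<zero>\<^bsub>A\<^esub> \<in> S \<and>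
     (\<forall>x\<in>S. \<forall>y\<in>S. x \<oplus>\<^bsub>A\<^esub> y \<in> S \<and> x \<otimes>\<^bsub>A\<^esub> y \<in> S) \<and>
     (\<forall>x\<in>S. (\<forall>c. cscale A c x \<in> S) \<and> cadj A x \<in> S) \<and>
     (\<forall>f x. (\<forall>n. f n \<in> S) \<and> x \<in> carrier A \<and> (\<lambda>n. cnrm A (f n \<ominus>\<^bsub>A\<^esub> x)) \<longlonglongrightarrow> 0 \<longrightarrow> x \<in> S)"

definition cstar_generated :: "'a cstar_structure \<Rightarrow> 'a set \<Rightarrow> 'a set" where
  "cstar_generated A X = \<Inter>{S. cstar_subalgebra A S \<and> X \<subseteq> S}"

definition cstar_hom :: "'a cstar_structure \<Rightarrow> 'b cstar_structure \<Rightarrow> ('a \<Rightarrow> 'b) \<Rightarrow> bool" where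
  "cstar_hom A B f \<longleftrightarrow>
     (\<forall>x\<in>carrier A. f x \<in> carrier B) \<and>
     (\<forall>x\<in>carrier A. \<forall>y\<in>carrier A.
        f (x \<oplus>\<^bsub>A\<^esub> y) = f x \<oplus>\<^bsub>B\<^esub> f y \<and> f (x \<otimes>\<^bsub>A\<^esub> y) = f x \<otimes>\<^bsub>B\<^esub> f y) \<and>
     (\<forall>x\<in>carrier A. (\<forall>c. f (cscale A c x) = cscale B c (f x)) \<and> f (cadj A x) = cadj B (f x))"

class cstar_algebra = real_normed_algebra + banach +
  fixes scaleC :: "complex \<Rightarrow> 'a \<Rightarrow> 'a"  (infixr \<open>*\<^sub>C\<close> 75)
    and adj :: "'a \<Rightarrow> 'a"
  assumes scaleC_add_right: "c *\<^sub>C (x + y) = c *\<^sub>C x + c *\<^sub>C y"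
    and scaleC_add_left: "(b + c) *\<^sub>C x = b *\<^sub>C x + c *\<^sub>C x"
    and scaleC_scaleC: "b *\<^sub>C (c *\<^sub>C x) = (b * c) *\<^sub>C x"
    and scaleR_scaleC: "r *\<^sub>R x = complex_of_real r *\<^sub>C x"
    and mult_scaleC_left: "(c *\<^sub>C x) * y = c *\<^sub>C (x * y)"
    and mult_scaleC_right: "x * (c *\<^sub>C y) = c *\<^sub>C (x * y)"
    and norm_scaleC: "norm (c *\<^sub>C x) = cmod c * norm x"
    and adj_adj: "adj (adj x) = x"
    and adj_add: "adj (x + y) = adj x + adj y"
    and adj_mult: "adj (x * y) = adj y * adj x"
    and adj_scaleC: "adj (c *\<^sub>C x) = cnj c *\<^sub>C adj x"
    and norm_adj_mult: "norm (adj x * x) = (norm x)\<^sup>2"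

definition type_cstar :: "'a::cstar_algebra cstar_structure" where
  "type_cstar = \<lparr>carrier = UNIV, mult = (*), one = undefined, zero = 0, add = (+),
     cscale = scaleC, cadj = adj, cnrm = norm\<rparr>"

lemma type_cstar_simps [simp]:
  "carrier (type_cstar :: 'a::cstar_algebra cstar_structure) = UNIV"
  "x \<otimes>\<^bsub>type_cstar\<^esub> y = x * (y :: 'a)"
  "\<zero>\<^bsub>type_cstar\<^esub> = (0 :: 'a)"
  "x \<oplus>\<^bsub>type_cstar\<^esub> y = x + (y :: 'a)"
  "cscale type_cstar c x = c *\<^sub>C (x :: 'a)"
  "cadj type_cstar x = adj (x :: 'a)"
  "cnrm type_cstar x = norm (x :: 'a)"
  by (simp_all add: type_cstar_def)

lemma abelian_group_type_cstar: "abelian_group (type_cstar :: 'a::cstar_algebra cstar_structure)"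
  by (rule abelian_groupI) (auto simp: add.assoc add.commute intro: exI[of _ "- _"] ab_left_minus)

lemma a_minus_type_cstar [simp]: "x \<ominus>\<^bsub>type_cstar\<^esub> y = x - (y :: 'a::cstar_algebra)"
proof -
  interpret abelian_group "type_cstar :: 'a cstar_structure"
    by (rule abelian_group_type_cstar)
  have "\<ominus>\<^bsub>type_cstar\<^esub> y = - y"
    by (rule minus_equality) auto
  then show ?thesis
    by (simp add: a_minus_def)
qed

lemma finsum_type_cstar [simp]:
  "finite S \<Longrightarrow> finsum type_cstar f S = (\<Sum>x\<in>S. f x :: 'a::cstar_algebra)"
proof (induction S rule: finite_induct)
  case empty
  interpret abelian_group "type_cstar :: 'a cstar_structure"
    by (rule abelian_group_type_cstar)
  show ?case by simp
next
  case (insert x F)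
  interpret abelian_group "type_cstar :: 'a cstar_structure"
    by (rule abelian_group_type_cstar)
  from insert show ?case by simp
qed

lemma cstar_structure_type_cstar: "cstar_structure (type_cstar :: 'a::cstar_algebra cstar_structure)"
proof -
  have *: "\<exists>x. (\<lambda>n. norm (f n - x)) \<longlonglongrightarrow> 0"
    if "\<forall>e>0. \<exists>N. \<forall>m\<ge>N. \<forall>n\<ge>N. norm (f m - f n) < e" for f :: "nat \<Rightarrow> 'a"
  proof -
    have "Cauchy f"
      using that by (auto simp: Cauchy_def dist_norm)
    then obtain x where "f \<longlonglongrightarrow> x"
      using Cauchy_convergent convergent_def by blast
    then show ?thesis
      by (auto simp: tendsto_norm_zero_iff LIM_zero_iff)
  qed
  have one: "1 *\<^sub>C x = x" for x :: 'a
    using scaleR_scaleC[of 1 x] by simp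
  show ?thesis
    by (intro cstar_structure.intro abelian_group_type_cstar cstar_structure_axioms.intro)
      (simp_all add: one * mult.assoc distrib_left distrib_right scaleC_add_right scaleC_add_left
        scaleC_scaleC mult_scaleC_left mult_scaleC_right norm_scaleC adj_adj adj_add adj_mult
        adj_scaleC norm_adj_mult norm_triangle_ineq norm_mult_ineq)
qed

definition closed_ideal :: "'a::cstar_algebra set \<Rightarrow> bool" where
  "closed_ideal J \<longleftrightarrow> closed J \<and> 0 \<in> J \<and> (\<forall>x\<in>J. \<forall>y\<in>J. x + y \<in> J) \<and> (\<forall>c. \<forall>x\<in>J. c *\<^sub>C x \<in> J) \<and>
     (\<forall>a. \<forall>x\<in>J. a * x \<in> J \<and> x * a \<in> J)"

definition closed_ideal_generated :: "'a::cstar_algebra set \<Rightarrow> 'a set" where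
  "closed_ideal_generated X = \<Inter>{J. closed_ideal J \<and> X \<subseteq> J}"

fun mult_list :: "'a::cstar_algebra list \<Rightarrow> 'a" where
  "mult_list [] = 0"
| "mult_list [x] = x"
| "mult_list (x # y # zs) = x * mult_list (y # zs)"

text \<open>
  The product of a finite nonempty family of commuting elements, multiplied in an arbitrarily
  chosen order.  There is no unit, so the empty product has no meaning; an exhaustive set of paths
  is never empty, because \<open>v \<in> v\<Lambda>\<close>.
\<close>
definition commuting_prod :: "('i \<Rightarrow> 'a::cstar_algebra) \<Rightarrow> 'i set \<Rightarrow> 'a" where
  "commuting_prod f E = mult_list (map f (SOME xs. distinct xs \<and> set xs = E))"


section \<open>Representations of \<open>\<Lambda> *\<^sub>d\<^sub>,\<^sub>s \<Lambda>\<close>\<close>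

text \<open>
  In the second relation an element of \<open>MCE(\<nu>, \<xi>)\<close> corresponds to exactly one pair
  \<open>(\<alpha>, \<beta>)\<close> by unique factorisation, so the sum runs over these pairs.
\<close>
definition ds_representation ::
  "('g, 'x) monoid_scheme \<Rightarrow> 'g set \<Rightarrow> ('m, 'g) graph_data \<Rightarrow> 'b cstar_structure \<Rightarrow>
    ('m \<Rightarrow> 'm \<Rightarrow> 'b) \<Rightarrow> bool" where
  "ds_representation G P \<Lambda> B \<tau> \<longleftrightarrow>
     (\<forall>(\<mu>, \<nu>)\<in>ds_pairs \<Lambda>. \<tau> \<mu> \<nu> \<in> carrier B \<and> cadj B (\<tau> \<mu> \<nu>) = \<tau> \<nu> \<mu>) \<and>
     (\<forall>(\<mu>, \<nu>)\<in>ds_pairs \<Lambda>. \<forall>(\<xi>, \<eta>)\<in>ds_pairs \<Lambda>.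
        \<tau> \<mu> \<nu> \<otimes>\<^bsub>B\<^esub> \<tau> \<xi> \<eta> =
        finsum B (\<lambda>(\<alpha>, \<beta>). \<tau> (cmp \<Lambda> \<mu> \<alpha>) (cmp \<Lambda> \<eta> \<beta>))
          {(\<alpha>, \<beta>). \<alpha> \<in> paths_to \<Lambda> (src \<Lambda> \<nu>) \<and> \<beta> \<in> paths_to \<Lambda> (src \<Lambda> \<xi>) \<and>
             cmp \<Lambda> \<nu> \<alpha> = cmp \<Lambda> \<xi> \<beta> \<and> cmp \<Lambda> \<nu> \<alpha> \<in> MCE G P \<Lambda> \<nu> \<xi>})"

text \<open>The C*-algebra \<open>C*(\<tau>)\<close>.\<close>
definition rep_algebra ::
  "('m, 'g) graph_data \<Rightarrow> 'b cstar_structure \<Rightarrow> ('m \<Rightarrow> 'm \<Rightarrow> 'b) \<Rightarrow> 'b cstar_structure" where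
  "rep_algebra \<Lambda> B \<tau> = B\<lparr>carrier := cstar_generated B ((\<lambda>(\<mu>, \<nu>). \<tau> \<mu> \<nu>) ` ds_pairs \<Lambda>)\<rparr>"

text \<open>
  A homomorphism from \<open>U\<close> to \<open>C*(\<tau>)\<close> intertwining \<open>\<omega>\<close> and \<open>\<tau>\<close>; when \<open>\<omega>\<close> is universal in \<open>U\<close>,
  this is \<open>\<rho>\<^sub>\<tau>\<close>.
\<close>
definition induced_hom ::
  "('m, 'g) graph_data \<Rightarrow> 'u cstar_structure \<Rightarrow> ('m \<Rightarrow> 'm \<Rightarrow> 'u) \<Rightarrow>
    'b cstar_structure \<Rightarrow> ('m \<Rightarrow> 'm \<Rightarrow> 'b) \<Rightarrow> ('u \<Rightarrow> 'b) \<Rightarrow> bool" where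
  "induced_hom \<Lambda> U \<omega> B \<tau> \<rho> \<longleftrightarrow> cstar_hom U (rep_algebra \<Lambda> B \<tau>) \<rho> \<and>
     (\<forall>(\<mu>, \<nu>)\<in>ds_pairs \<Lambda>. \<rho> (\<omega> \<mu> \<nu>) = \<tau> \<mu> \<nu>)"

text \<open>
  \<open>U\<close> is the universal C*-algebra \<open>\<B>\<^sub>\<Lambda>\<close>, generated by the representation \<open>\<omega>\<close>.  HOL cannot
  quantify over all types inside a formula, so the universal property is tested on the C*-algebras
  whose underlying set is a subset of the type \<open>real\<close>.  This is no restriction: \<open>\<Lambda>\<close> is countable,
  so every \<open>C*(\<tau>)\<close> is separable, has at most continuum many elements, and therefore has an
  isomorphic copy of this form.
\<close>
definition universal_representation ::
  "('g, 'x) monoid_scheme \<Rightarrow> 'g set \<Rightarrow> ('m, 'g) graph_data \<Rightarrow> 'u cstar_structure \<Rightarrow>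
    ('m \<Rightarrow> 'm \<Rightarrow> 'u) \<Rightarrow> bool" where
  "universal_representation G P \<Lambda> U \<omega> \<longleftrightarrow>
     cstar_structure U \<and> ds_representation G P \<Lambda> U \<omega> \<and>
     carrier (rep_algebra \<Lambda> U \<omega>) = carrier U \<and>
     (\<forall>(B :: real cstar_structure) \<tau>.
        cstar_structure B \<and> ds_representation G P \<Lambda> B \<tau> \<longrightarrow> (\<exists>\<rho>. induced_hom \<Lambda> U \<omega> B \<tau> \<rho>))"

end

theory Submission
  imports Defs
begin

text \<open>
  Write \<open>I\<close> for the closed ideal generated by the gap projections
  \<open>\<Prod>\<^bsub>\<alpha>\<in>E\<^esub> (\<omega>\<^bsub>\<mu>,\<mu>\<^esub> - \<omega>\<^bsub>\<mu>\<alpha>,\<mu>\<alpha>\<^esub>)\<close> that \<open>\<rho>\<close> annihilates.  Homomorphisms of C*-algebras are contractive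
  (\<open>norm_hom_le\<close>), so the kernel of \<open>\<rho>\<close> is a closed ideal and contains \<open>I\<close>.  For the converse,
  generators of one degree multiply like matrix units, and a product of generators of degrees \<open>p\<close>
  and \<open>q\<close> is a sum of generators of degree \<open>p \<or> q\<close>.  Hence a finite set \<open>D\<close> of degrees that is closed
  under joins spans a *-algebra, and when \<open>p\<close> is minimal in \<open>D\<close> the degrees in \<open>D - {p}\<close> span an ideal
  of it.  Both halves of the argument are inductions along this ideal.

  The algebraic half is \<open>kernel_core_subset_gap_ideal\<close>: a finite linear combination of generators in
  the kernel of \<open>\<rho>\<close> belongs to \<open>I\<close>.  If \<open>\<omega>\<^bsub>\<mu>,\<nu>\<^esub>\<close> has minimal degree and occurs with a nonzero coefficient,
  then compressing to its corner and multiplying by the gap projection \<open>q\<close> of the finitely many paths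
  \<open>\<alpha>\<close> for which some \<open>\<omega>\<^bsub>\<mu>\<alpha>,\<eta>\<^esub>\<close> interferes isolates \<open>q \<omega>\<^bsub>\<mu>,\<nu>\<^esub>\<close>, so \<open>\<rho> q = 0\<close>.  Since no \<open>\<tau>\<^bsub>\<lambda>,\<lambda>\<^esub>\<close>
  vanishes, the gap projection of a set that is not exhaustive has a nonzero image; thus \<open>q\<close> is one
  of the generators of \<open>I\<close>.  Modulo \<open>I\<close> the term \<open>\<omega>\<^bsub>\<mu>,\<nu>\<^esub>\<close> is therefore a combination of the other
  degrees, and finitely many such replacements remove the degree \<open>p\<close>.

  The analytic half passes from finite combinations to limits.  Finitely many generators lie in a
  finite-dimensional *-algebra (\<open>finite_dimensional_subalgebra_hull\<close>).  In such an algebra the kernel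
  of \<open>\<rho>\<close> has a unit, and \<open>\<rho>\<close> is isometric on the complement, so every element \<open>a\<close> is within
  \<open>\<parallel>\<rho> a\<parallel>\<close> of the kernel (\<open>ex_kernel_approximation\<close>).  Approximating an element \<open>x\<close> of the kernel by
  finite combinations \<open>a\<close>, where \<open>\<parallel>\<rho> a\<parallel> \<le> \<parallel>a - x\<parallel>\<close>, exhibits \<open>x\<close> as a limit of elements of \<open>I\<close>.
\<close>

section \<open>Elementary C*-algebra\<close>

lemma scaleC_one [simp]: "1 *\<^sub>C (x::'a::cstar_algebra) = x"
  using scaleR_scaleC[of 1 x] by simp

lemma scaleC_zero_right [simp]: "c *\<^sub>C (0::'a::cstar_algebra) = 0"
  using scaleC_add_right[of c 0 "0::'a"] by simp

lemma scaleC_zero_left [simp]: "0 *\<^sub>C (x::'a::cstar_algebra) = 0"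
  using scaleC_add_left[of 0 0 x] by simp

lemma scaleC_minus_right: "c *\<^sub>C (- x::'a::cstar_algebra) = - (c *\<^sub>C x)"
  using scaleC_add_right[of c x "- x"] by (simp add: add_eq_0_iff)

lemma scaleC_diff_right: "c *\<^sub>C (x - y::'a::cstar_algebra) = c *\<^sub>C x - c *\<^sub>C y"
  using scaleC_add_right[of c x "- y"] by (simp add: scaleC_minus_right)

lemma scaleC_scaleR: "c *\<^sub>C (r *\<^sub>R (x::'a::cstar_algebra)) = r *\<^sub>R (c *\<^sub>C x)"
  by (simp add: scaleR_scaleC scaleC_scaleC mult.commute)

lemma bounded_linear_scaleC: "bounded_linear (\<lambda>x::'a::cstar_algebra. c *\<^sub>C x)"
  by (rule bounded_linear_intro[where K = "cmod c"])
    (simp_all add: scaleC_add_right scaleC_scaleR norm_scaleC mult.commute)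

lemma adj_scaleR: "adj (r *\<^sub>R (x::'a::cstar_algebra)) = r *\<^sub>R adj x"
  by (simp add: scaleR_scaleC adj_scaleC)

lemma adj_zero [simp]: "adj (0::'a::cstar_algebra) = 0"
  using adj_scaleR[of 0 "0::'a"] by simp

lemma adj_minus: "adj (- x::'a::cstar_algebra) = - adj x"
  using adj_scaleR[of "-1" x] by simp

lemma adj_diff: "adj (x - y::'a::cstar_algebra) = adj x - adj y"
  using adj_add[of x "- y"] by (simp add: adj_minus)

lemma adj_sum: "adj (\<Sum>i\<in>S. f i) = (\<Sum>i\<in>S. adj (f i :: 'a::cstar_algebra))"
  by (induction S rule: infinite_finite_induct) (auto simp: adj_add)

lemma adj_eq_0_iff [simp]: "adj (x::'a::cstar_algebra) = 0 \<longleftrightarrow> x = 0"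
  by (metis adj_adj adj_zero)

lemma norm_adj: "norm (adj x) = norm (x::'a::cstar_algebra)"
proof -
  have *: "norm x \<le> norm (adj x)" for x :: 'a
  proof (cases "x = 0")
    case False
    have "norm x * norm x \<le> norm (adj x) * norm x"
      using norm_adj_mult[of x] norm_mult_ineq[of "adj x" x] by (simp add: power2_eq_square)
    then show ?thesis using False by simp
  qed simp
  show ?thesis using *[of x] *[of "adj x"] by (simp add: adj_adj)
qed

lemma bounded_linear_adj: "bounded_linear (adj :: 'a::cstar_algebra \<Rightarrow> 'a)"
  by (rule bounded_linear_intro[where K = 1]) (simp_all add: adj_add adj_scaleR norm_adj)

lemma adj_mult_eq_0_iff: "adj x * x = 0 \<longleftrightarrow> (x::'a::cstar_algebra) = 0"
  using norm_adj_mult[of x] by (metis norm_eq_zero power_eq_0_iff mult_zero_right zero_neq_numeral)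

text \<open>This holds by the C*-identity, since \<open>(h y)\<^sup>* (h y) = y\<^sup>* h\<^sup>2 y\<close>.\<close>
lemma selfadjoint_mult_cancel:
  fixes h :: "'a::cstar_algebra"
  assumes "adj h = h" and "h * (h * y) = 0"
  shows "h * y = 0"
proof -
  have "adj (h * y) * (h * y) = adj y * (h * (h * y))"
    using assms(1) by (simp add: adj_mult mult.assoc)
  then show ?thesis
    using assms(2) by (simp add: adj_mult_eq_0_iff)
qed

locale star_hom =
  fixes \<rho> :: "'a::cstar_algebra \<Rightarrow> 'b::cstar_algebra"
  assumes hom_add: "\<rho> (x + y) = \<rho> x + \<rho> y"
    and hom_mult: "\<rho> (x * y) = \<rho> x * \<rho> y"
    and hom_scaleC: "\<rho> (c *\<^sub>C x) = c *\<^sub>C \<rho> x"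
    and hom_adj: "\<rho> (adj x) = adj (\<rho> x)"
begin

lemma hom_scaleR: "\<rho> (r *\<^sub>R x) = r *\<^sub>R \<rho> x"
  by (simp add: scaleR_scaleC hom_scaleC)

lemma linear_hom: "linear \<rho>"
  by (rule linearI) (simp_all add: hom_add hom_scaleR)

lemmas hom_zero = linear_0[OF linear_hom]
  and hom_diff = linear_diff[OF linear_hom]

end


section \<open>Homomorphisms of C*-algebras are contractive\<close>

text \<open>
  The element \<open>c\<close> is \<open>1 - sqrt (1 - h\<^sup>2)\<close>, which lies in the algebra even in the absence of a unit: it
  is the fixed point of \<open>c \<mapsto> (h\<^sup>2 + c\<^sup>2) / 2\<close>, a contraction with constant \<open>\<parallel>h\<parallel>\<close> on the ball of radius
  \<open>\<parallel>h\<parallel>\<close>.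
\<close>
lemma ex_one_minus_sqrt:
  fixes h :: "'a::cstar_algebra"
  assumes h: "adj h = h" and norm_h: "norm h < 1"
  obtains c where "adj c = c" and "c * h = h * c" and "c + c = h * h + c * c"
proof -
  define S where "S = {c. adj c = c \<and> c * h = h * c \<and> norm c \<le> norm h}"
  define f where "f c = (1/2) *\<^sub>R (h * h + c * c)" for c
  have "closed S"
    unfolding S_def
    by (intro closed_Collect_conj closed_Collect_eq closed_Collect_le continuous_intros
        linear_continuous_on bounded_linear_adj)
  then have "complete S"
    by (simp add: complete_eq_closed)
  moreover have "S \<noteq> {}"
    by (auto simp: S_def intro!: exI[of _ 0])
  moreover have "f ` S \<subseteq> S"
  proof safe
    fix c assume c: "c \<in> S"
    have "norm (f c) \<le> (1/2) * (norm h * norm h + norm c * norm c)"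
      unfolding f_def
      using norm_triangle_ineq[of "h * h" "c * c"] norm_mult_ineq[of h h] norm_mult_ineq[of c c]
      by simp
    also have "\<dots> \<le> (1/2) * (norm h * 1 + norm h * 1)"
      using c norm_h unfolding S_def
      by (intro mult_left_mono add_mono mult_mono) auto
    finally have "norm (f c) \<le> norm h" by simp
    moreover have "c * c * h = h * (c * c)"
    proof -
      have ch: "c * h = h * c" using c by (simp add: S_def)
      show ?thesis by (metis ch mult.assoc)
    qed
    ultimately show "f c \<in> S"
      using c h by (simp add: S_def f_def adj_scaleR adj_add adj_mult distrib_left distrib_right mult.assoc)
  qed
  moreover have "dist (f x) (f y) \<le> norm h * dist x y" if xy: "x \<in> S" "y \<in> S" for x y
  proof -
    have "f x - f y = (1/2) *\<^sub>R (x * (x - y) + (x - y) * y)"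
      by (simp add: f_def algebra_simps)
    then have "norm (f x - f y) \<le> (1/2) * (norm x * norm (x - y) + norm (x - y) * norm y)"
      using norm_triangle_ineq[of "x * (x - y)" "(x - y) * y"] norm_mult_ineq[of x "x - y"]
        norm_mult_ineq[of "x - y" y] by simp
    also have "\<dots> \<le> (1/2) * (norm h * norm (x - y) + norm (x - y) * norm h)"
      using xy unfolding S_def by (intro mult_left_mono add_mono mult_right_mono) auto
    finally show ?thesis
      by (simp add: dist_norm)
  qed
  ultimately have "\<exists>!c\<in>S. f c = c"
    using norm_h by (intro Banach_fix[of S "norm h" f]) simp_all
  then obtain c where c: "c \<in> S" "f c = c"
    by blast
  have "c + c = 2 *\<^sub>R f c"
    using c(2) by (simp add: scaleR_2)
  then have "c + c = h * h + c * c"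
    by (simp add: f_def)
  with c(1) that show thesis
    by (auto simp: S_def)
qed

text \<open>
  The equation for \<open>d\<close> reads \<open>k\<^sup>2 + (1 - d)\<^sup>2 = 1\<close>, so \<open>k \<plusminus> \<i> (1 - d)\<close> are unitaries with mean \<open>k\<close>.
  Left multiplication by them makes sense without a unit and is isometric by the C*-identity, so
  \<open>\<parallel>k y\<parallel> \<le> \<parallel>y\<parallel>\<close> for all \<open>y\<close>; the choice \<open>y = k\<close> gives the bound.
\<close>
lemma norm_le_1_of_one_minus_sqrt:
  fixes k :: "'a::cstar_algebra"
  assumes k: "adj k = k" and d: "adj d = d" and comm: "d * k = k * d"
    and sqrt: "d + d = k * k + d * d"
  shows "norm k \<le> 1"
proof -
  have isometric: "norm (k * y + z *\<^sub>C (y - d * y)) = norm y" if z: "z = \<i> \<or> z = - \<i>" for y z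
  proof -
    have zz: "cnj z * z = 1" "cnj z = - z"
      using z by auto
    have "adj (k * y + z *\<^sub>C (y - d * y)) * (k * y + z *\<^sub>C (y - d * y)) =
        adj y * (k * (k * y)) + (cnj z * z) *\<^sub>C (adj y * (y - d * y - d * (y - d * y)))
        + z *\<^sub>C (adj y * (k * (y - d * y))) + cnj z *\<^sub>C (adj y * (k * y - d * (k * y)))"
      by (simp add: adj_add adj_mult adj_scaleC adj_diff k d distrib_left distrib_right
          mult_scaleC_left mult_scaleC_right scaleC_scaleC mult.commute[of z "cnj z"] scaleC_add_right scaleC_diff_right
          left_diff_distrib right_diff_distrib mult.assoc)
    also have "k * y - d * (k * y) = k * (y - d * y)"
      by (simp add: right_diff_distrib comm mult.assoc[symmetric])
    also have "adj y * (k * (k * y)) + (cnj z * z) *\<^sub>C (adj y * (y - d * y - d * (y - d * y)))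
        = adj y * y + adj y * ((k * k + d * d - (d + d)) * y)"
      unfolding zz(1) by (simp add: algebra_simps)
    also have "\<dots> = adj y * y"
      by (simp add: sqrt)
    finally have "adj (k * y + z *\<^sub>C (y - d * y)) * (k * y + z *\<^sub>C (y - d * y)) = adj y * y"
      using scaleC_add_left[of z "- z" "adj y * (k * (y - d * y))"] by (simp add: zz add.assoc)
    then have "(norm (k * y + z *\<^sub>C (y - d * y)))\<^sup>2 = (norm y)\<^sup>2"
      by (metis norm_adj_mult)
    then show ?thesis by simp
  qed
  have "2 *\<^sub>R (k * k) = (k * k + \<i> *\<^sub>C (k - d * k)) + (k * k + (- \<i>) *\<^sub>C (k - d * k))"
    using scaleC_add_left[of \<i> "- \<i>" "k - d * k"] by (simp add: scaleR_2 algebra_simps)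
  then have "norm (2 *\<^sub>R (k * k)) \<le> norm k + norm k"
    by (metis isometric norm_triangle_ineq)
  then have "norm k * norm k \<le> norm k * 1"
    using norm_adj_mult[of k] k by (simp add: power2_eq_square)
  then show ?thesis
    by (cases "k = 0") auto
qed

text \<open>
  A homomorphism carries the square root equation of \<open>ex_one_minus_sqrt\<close> to its target, where it
  bounds the norm by \<open>norm_le_1_of_one_minus_sqrt\<close>.  This is the estimate usually obtained from spectral radii.
\<close>
lemma (in star_hom) norm_hom_le: "norm (\<rho> x) \<le> norm x"
proof -
  have le1: "norm (\<rho> h) \<le> 1" if h: "adj h = h" "norm h < 1" for h
  proof -
    obtain c where c: "adj c = c" "c * h = h * c" "c + c = h * h + c * c"
      using ex_one_minus_sqrt[OF h] .
    have "\<rho> c + \<rho> c = \<rho> h * \<rho> h + \<rho> c * \<rho> c"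
      using arg_cong[OF c(3), of \<rho>] by (simp add: hom_add hom_mult)
    then show ?thesis
      using h c by (intro norm_le_1_of_one_minus_sqrt[of _ "\<rho> c"])
        (simp_all flip: hom_adj hom_mult)
  qed
  \<comment> \<open>The slack \<open>e\<close> makes the norm of the rescaled \<open>x\<^sup>* x\<close> strictly less than one.\<close>
  have "(norm (\<rho> x))\<^sup>2 \<le> (norm x)\<^sup>2 + e" if e: "e > 0" for e
  proof -
    define t where "t = (norm x)\<^sup>2 + e"
    have t: "t > 0" using e by (simp add: t_def add_nonneg_pos)
    define h where "h = (1/t) *\<^sub>R (adj x * x)"
    have "norm h < 1"
      using e t by (simp add: h_def norm_adj_mult) (simp add: t_def)
    moreover have "adj h = h"
      by (simp add: h_def adj_scaleR adj_mult adj_adj)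
    ultimately have "norm (\<rho> h) \<le> 1" using le1 by simp
    moreover have "norm (\<rho> h) = (1/t) * (norm (\<rho> x))\<^sup>2"
      using t by (simp add: h_def hom_scaleR hom_mult hom_adj norm_adj_mult)
    ultimately show ?thesis using t unfolding t_def[symmetric] by (simp add: field_simps)
  qed
  then have "(norm (\<rho> x))\<^sup>2 \<le> (norm x)\<^sup>2"
    by (rule field_le_epsilon)
  then show ?thesis
    by (simp add: power2_le_iff_abs_le)
qed

lemma (in star_hom) closed_ideal_kernel: "closed_ideal {x. \<rho> x = 0}"
proof -
  have "bounded_linear \<rho>"
    by (rule bounded_linear_intro[where K = 1]) (simp_all add: hom_add hom_scaleR norm_hom_le)
  then have "closed {x. \<rho> x = 0}"
    by (intro closed_Collect_eq linear_continuous_on continuous_on_const)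
  then show ?thesis
    by (auto simp: closed_ideal_def hom_zero hom_add hom_scaleC hom_mult)
qed


section \<open>Finite-dimensional subspaces of normed spaces\<close>

text \<open>
  The constant is the inverse of the distance from \<open>x\<close> to \<open>S\<close>, because for \<open>t \<noteq> 0\<close> the vector
  \<open>s + t x\<close> is \<open>t\<close> times the difference of \<open>x\<close> and an element of \<open>S\<close>.
\<close>
lemma coefficient_bound:
  fixes S :: "'a::real_normed_vector set"
  assumes S: "closed S" "subspace S" and x: "x \<notin> S"
  obtains C where "C \<ge> 0" and "\<And>s t. s \<in> S \<Longrightarrow> \<bar>t\<bar> \<le> C * norm (s + t *\<^sub>R x)"
proof
  have d: "infdist x S > 0"
    using S x subspace_0 by (metis empty_iff infdist_pos_not_in_closed)
  show "1 / infdist x S \<ge> 0" using d by simp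
  fix s t assume s: "s \<in> S"
  show "\<bar>t\<bar> \<le> (1 / infdist x S) * norm (s + t *\<^sub>R x)"
  proof (cases "t = 0")
    case False
    have "infdist x S \<le> dist x ((- (1/t)) *\<^sub>R s)"
      using s S(2) by (intro infdist_le subspace_scale)
    also have "\<dots> = norm ((1/t) *\<^sub>R (s + t *\<^sub>R x))"
      using False by (simp add: dist_norm scaleR_add_right add.commute)
    also have "\<dots> = norm (s + t *\<^sub>R x) / \<bar>t\<bar>"
      by simp
    finally show ?thesis using d False by (simp add: field_simps)
  qed (use d in simp)
qed

text \<open>
  By induction: the coefficients at a new vector of a convergent sequence form a Cauchy sequence, by
  \<open>coefficient_bound\<close>, and after subtracting them the limit is taken inside the smaller span.
\<close>
lemma closed_span_finite:
  fixes B :: "'a::real_normed_vector set"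
  assumes "finite B"
  shows "closed (span B)"
  using assms
proof induction
  case (insert b B)
  show ?case
  proof (cases "b \<in> span B")
    case True
    then show ?thesis using insert.IH by (simp add: span_redundant)
  next
    case False
    obtain C where C: "C \<ge> 0" "\<And>s t. s \<in> span B \<Longrightarrow> \<bar>t\<bar> \<le> C * norm (s + t *\<^sub>R b)"
      using coefficient_bound[OF insert.IH subspace_span False] by blast
    show ?thesis
      unfolding closed_sequential_limits
    proof (intro allI impI, elim conjE)
      fix y l assume "\<forall>n::nat. y n \<in> span (insert b B)" and lim: "y \<longlonglongrightarrow> l"
      then have "\<forall>n. \<exists>t. y n - t *\<^sub>R b \<in> span B"
        by (simp add: span_breakdown_eq)
      then obtain t where t: "\<And>n. y n - t n *\<^sub>R b \<in> span B" by metis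
      have "Cauchy t"
      proof (rule CauchyI)
        fix e :: real assume e: "e > 0"
        have "Cauchy y" using lim by (rule LIMSEQ_imp_Cauchy)
        moreover have "e / (C + 1) > 0" using e C(1) by simp
        ultimately obtain N where N: "\<And>m n. m \<ge> N \<Longrightarrow> n \<ge> N \<Longrightarrow> norm (y m - y n) < e / (C + 1)"
          by (metis CauchyD)
        show "\<exists>N. \<forall>m\<ge>N. \<forall>n\<ge>N. norm (t m - t n) < e"
        proof (intro exI allI impI)
          fix m n assume mn: "m \<ge> N" "n \<ge> N"
          have "\<bar>t m - t n\<bar> \<le> C * norm ((y m - t m *\<^sub>R b - (y n - t n *\<^sub>R b)) + (t m - t n) *\<^sub>R b)"
            by (intro C(2) span_diff t)
          also have "\<dots> = C * norm (y m - y n)"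
            by (simp add: algebra_simps)
          also have "\<dots> \<le> C * (e / (C + 1))"
            using N[OF mn] C(1) by (intro mult_left_mono) auto
          also have "\<dots> < e"
            using e C(1) by (simp add: field_simps)
          finally show "norm (t m - t n) < e" by simp
        qed
      qed
      then obtain t0 where "t \<longlonglongrightarrow> t0"
        using Cauchy_convergent convergent_def by blast
      with lim have "(\<lambda>n. y n - t n *\<^sub>R b) \<longlonglongrightarrow> l - t0 *\<^sub>R b"
        by (intro tendsto_intros)
      then have "l - t0 *\<^sub>R b \<in> span B"
        by (rule closed_sequentially[OF insert.IH t])
      then show "l \<in> span (insert b B)"
        by (auto simp: span_breakdown_eq)
    qed
  qed
qed simp

lemma injective_on_span_bounded_below:
  fixes f :: "'a::real_normed_vector \<Rightarrow> 'b::real_normed_vector"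
  assumes "finite B" and f: "linear f" and "\<And>x. x \<in> span B \<Longrightarrow> f x = 0 \<Longrightarrow> x = 0"
  shows "\<exists>C\<ge>0. \<forall>x\<in>span B. norm x \<le> C * norm (f x)"
  using assms(1,3)
proof induction
  case empty
  then show ?case by (intro exI[of _ 1]) auto
next
  case (insert b B)
  have sub: "span B \<subseteq> span (insert b B)" by (intro span_mono) auto
  then obtain C where C: "C \<ge> 0" "\<And>x. x \<in> span B \<Longrightarrow> norm x \<le> C * norm (f x)"
    using insert.IH insert.prems by blast
  show ?case
  proof (cases "b \<in> span B")
    case True
    then show ?thesis using C by (auto simp: span_redundant)
  next
    case False
    have "f b \<notin> span (f ` B)"
    proof
      assume "f b \<in> span (f ` B)"
      then obtain s where s: "s \<in> span B" "f b = f s"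
        using linear_span_image[OF f, of B] by auto
      then have "f (b - s) = 0" "b - s \<in> span (insert b B)"
        using f sub by (auto simp: linear_diff intro: span_diff span_base)
      then have "b = s" using insert.prems by force
      with s False show False by simp
    qed
    then obtain D where D: "D \<ge> 0" "\<And>s t. s \<in> span (f ` B) \<Longrightarrow> \<bar>t\<bar> \<le> D * norm (s + t *\<^sub>R f b)"
      using coefficient_bound[OF closed_span_finite subspace_span] insert.hyps by blast
    show ?thesis
    proof (intro exI conjI ballI)
      show "C * (1 + D * norm (f b)) + D * norm b \<ge> 0" using C D by simp
      fix x assume "x \<in> span (insert b B)"
      then obtain t where t: "x - t *\<^sub>R b \<in> span B" by (auto simp: span_breakdown_eq)
      define s where "s = x - t *\<^sub>R b"
      have x: "x = s + t *\<^sub>R b" by (simp add: s_def)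
      have fx: "f x = f s + t *\<^sub>R f b" using f by (simp add: x linear_add linear_scale)
      have s: "s \<in> span B" using t by (simp add: s_def)
      have tb: "\<bar>t\<bar> \<le> D * norm (f x)"
        unfolding fx using s by (intro D(2)) (simp add: linear_span_image[OF f])
      have "norm (f s) \<le> norm (f x) + \<bar>t\<bar> * norm (f b)"
        using norm_triangle_ineq4[of "f x" "t *\<^sub>R f b"] by (simp add: fx)
      also have "\<dots> \<le> norm (f x) + D * norm (f x) * norm (f b)"
        using tb by (intro add_left_mono mult_right_mono) auto
      finally have fs: "norm (f s) \<le> norm (f x) + D * norm (f x) * norm (f b)" .
      have "norm x \<le> norm s + \<bar>t\<bar> * norm b"
        unfolding x by (rule order_trans[OF norm_triangle_ineq]) simp
      also have "\<dots> \<le> C * norm (f s) + D * norm (f x) * norm b"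
        using C(2)[OF s] tb by (intro add_mono mult_right_mono) auto
      also have "\<dots> \<le> C * (norm (f x) + D * norm (f x) * norm (f b)) + D * norm (f x) * norm b"
        using fs C(1) by (intro add_right_mono mult_left_mono) auto
      finally show "norm x \<le> (C * (1 + D * norm (f b)) + D * norm b) * norm (f x)"
        by (simp add: algebra_simps)
    qed
  qed
qed

lemma finite_basis:
  fixes W :: "'a::real_vector set"
  assumes "subspace W" and "W \<subseteq> span Y" and "finite Y"
  obtains B where "finite B" and "independent B" and "B \<subseteq> W" and "span B = W"
proof -
  obtain B where B: "B \<subseteq> W" "independent B" "W \<subseteq> span B"
    using maximal_independent_subset by metis
  moreover have "finite B"
    using independent_span_bound[of Y B] assms B by blast
  moreover have "span B = W"
    using B assms(1) by (metis span_minimal subset_antisym)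
  ultimately show thesis using that by blast
qed

text \<open>
  The image of a basis is independent with the same number of elements, so it is again a basis.
\<close>
lemma injective_imp_surjective_on_subspace:
  fixes f :: "'a::real_vector \<Rightarrow> 'a"
  assumes W: "subspace W" "W \<subseteq> span Y" "finite Y"
    and f: "linear f" "f ` W \<subseteq> W" and inj: "\<And>x. x \<in> W \<Longrightarrow> f x = 0 \<Longrightarrow> x = 0"
  shows "f ` W = W"
proof -
  obtain B where B: "finite B" "independent B" "B \<subseteq> W" "span B = W"
    using finite_basis[OF W] .
  have inj': "inj_on f (span B)"
  proof (rule inj_onI)
    fix x y assume "x \<in> span B" "y \<in> span B" "f x = f y"
    then have "x - y \<in> W" "f (x - y) = 0"
      using B(4) W(1) f(1) by (auto simp: linear_diff subspace_diff)
    then show "x = y" using inj[of "x - y"] by simp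
  qed
  then have indep: "independent (f ` B)"
    using linear_independent_injective_image[OF f(1) B(2)] by simp
  have card: "card (f ` B) = card B"
    using inj' by (intro card_image) (metis inj_on_subset span_superset)
  have "W \<subseteq> span (f ` B)"
  proof (rule ccontr)
    assume "\<not> W \<subseteq> span (f ` B)"
    then obtain w where w: "w \<in> W" "w \<notin> span (f ` B)" by blast
    have "independent (insert w (f ` B))"
      using w indep by (simp add: independent_insertI)
    moreover have "insert w (f ` B) \<subseteq> span B"
      using w B f(2) by auto
    ultimately have "card (insert w (f ` B)) \<le> card B"
      using independent_span_bound[OF B(1)] by blast
    moreover have "w \<notin> f ` B" using w by (metis span_base)
    ultimately show False using B(1) card by simp
  qed
  then show ?thesis
    using f(2) B(4) linear_span_image[OF f(1), of B] by auto
qed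


section \<open>Finite-dimensional *-algebras\<close>

text \<open>
  The scalars are real because bases and their cardinalities are taken in real vector spaces.
\<close>
definition star_subalgebra :: "'a::cstar_algebra set \<Rightarrow> bool" where
  "star_subalgebra A \<longleftrightarrow> subspace A \<and> (\<forall>x\<in>A. \<forall>y\<in>A. x * y \<in> A) \<and> (\<forall>x\<in>A. adj x \<in> A)"

text \<open>
  The projection \<open>e\<close> is the support of \<open>k\<close>.  Multiplication by \<open>k\<close> is injective, hence surjective, on the
  finite-dimensional space \<open>k K\<close>, so \<open>k = k\<^sup>2 z\<close> for some \<open>z \<in> K\<close>, and \<open>k z\<close> is the projection.
\<close>
lemma ex_support_projection:
  fixes K :: "'a::cstar_algebra set"
  assumes K: "star_subalgebra K" "K \<subseteq> span Y" "finite Y" and k: "k \<in> K" "adj k = k"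
  obtains e where "e \<in> K" and "adj e = e" and "e * e = e" and "e * k = k"
    and "\<And>y. k * y = 0 \<Longrightarrow> e * y = 0"
proof -
  have sub: "subspace K" and mult: "\<And>x y. x \<in> K \<Longrightarrow> y \<in> K \<Longrightarrow> x * y \<in> K"
    using K(1) by (auto simp: star_subalgebra_def)
  define W where "W = (\<lambda>x. k * x) ` K"
  have lin: "linear (\<lambda>x. k * x)"
    by (rule linearI) (simp_all add: distrib_left)
  have WK: "W \<subseteq> K" using k mult by (auto simp: W_def)
  have W: "(\<lambda>x. k * x) ` W = W"
  proof (rule injective_imp_surjective_on_subspace[OF _ _ K(3) lin])
    show "subspace W" unfolding W_def by (rule linear_subspace_image[OF lin sub])
    show "W \<subseteq> span Y" using WK K(2) by blast
    show "(\<lambda>x. k * x) ` W \<subseteq> W" using WK by (auto simp: W_def)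
    show "x = 0" if "x \<in> W" "k * x = 0" for x
      using that selfadjoint_mult_cancel[OF k(2)] by (auto simp: W_def)
  qed
  have "k * k \<in> W" using k by (simp add: W_def)
  then have "k * k \<in> (\<lambda>x. k * x) ` (\<lambda>x. k * x) ` W" by (simp add: W)
  then obtain w where w: "w \<in> W" "k * k = k * (k * w)" by blast
  then obtain z where z: "z \<in> K" "w = k * z" by (auto simp: W_def)
  have kkz: "k = k * (k * z)"
  proof -
    define y where "y = k - k * (k * z)"
    have "adj y = k - adj z * (k * k)"
      by (simp add: y_def adj_diff adj_mult k(2) mult.assoc)
    moreover have "k * y = 0"
      using w(2) z(2) by (simp add: y_def right_diff_distrib)
    ultimately have "adj y * y = 0"
      by (simp add: left_diff_distrib mult.assoc)
    then show ?thesis by (simp add: adj_mult_eq_0_iff y_def)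
  qed
  have kzk: "k = adj z * k * k"
    using arg_cong[OF kkz, of adj] by (simp add: adj_mult k(2) mult.assoc)
  define e where "e = k * z"
  have e': "e = adj z * k"
    unfolding e_def by (subst kzk) (simp add: mult.assoc flip: kkz)
  show thesis
  proof
    show "e \<in> K" using k z mult by (simp add: e_def)
    show "adj e = e" by (metis e' e_def adj_mult k(2))
    show "e * e = e"
    proof -
      have "e * e = adj z * (k * (k * z))" by (metis e' e_def mult.assoc)
      then show ?thesis by (simp add: e' flip: kkz)
    qed
    show "e * k = k" by (metis e' kzk)
    show "e * y = 0" if "k * y = 0" for y using that by (simp add: e' mult.assoc)
  qed
qed

text \<open>
  Starting from \<open>0\<close>, each basis element \<open>x\<close> enlarges the projection \<open>e\<close> found so far by the support
  projection of \<open>h h\<^sup>*\<close>, where \<open>h = x - e x\<close> is the part of \<open>x\<close> that \<open>e\<close> misses.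
\<close>
lemma ex_unit_of_finite_dimensional:
  fixes K :: "'a::cstar_algebra set"
  assumes K: "star_subalgebra K" "K \<subseteq> span Y" "finite Y"
  obtains e where "e \<in> K" and "adj e = e" and "\<And>x. x \<in> K \<Longrightarrow> e * x = x" and "\<And>x. x \<in> K \<Longrightarrow> x * e = x"
proof -
  have sub: "subspace K" and mult: "\<And>x y. x \<in> K \<Longrightarrow> y \<in> K \<Longrightarrow> x * y \<in> K"
    and adj: "\<And>x. x \<in> K \<Longrightarrow> adj x \<in> K"
    using K(1) by (auto simp: star_subalgebra_def)
  have *: "\<exists>e\<in>K. adj e = e \<and> e * e = e \<and> (\<forall>x\<in>F. e * x = x)" if "finite F" "F \<subseteq> K" for F
    using that
  proof induction
    case empty
    then show ?case using subspace_0[OF sub] by (intro bexI[of _ 0]) auto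
  next
    case (insert x F)
    then obtain e where e: "e \<in> K" "adj e = e" "e * e = e" "\<And>y. y \<in> F \<Longrightarrow> e * y = y"
      by auto
    define h where "h = x - e * x"
    have h: "h \<in> K" "e * h = 0"
      using insert.prems e mult subspace_diff[OF sub]
      by (auto simp: h_def right_diff_distrib simp flip: mult.assoc)
    have sa: "adj (h * adj h) = h * adj h" by (simp add: adj_mult adj_adj)
    obtain q where q: "q \<in> K" "adj q = q" "q * q = q" "q * (h * adj h) = h * adj h"
      "\<And>y. (h * adj h) * y = 0 \<Longrightarrow> q * y = 0"
      using ex_support_projection[OF K mult[OF h(1) adj[OF h(1)]] sa] by blast
    have "adj h * e = 0" using arg_cong[OF h(2), of adj] by (simp add: adj_mult e(2))
    then have qe: "q * e = 0" by (intro q(5)) (simp add: mult.assoc)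
    then have eq: "e * q = 0" by (metis adj_mult adj_zero e(2) q(2))
    have qh: "q * h = h"
    proof -
      define g where "g = h - q * h"
      have "adj (adj g) * adj g = h * adj h - (h * adj h) * q - (q * (h * adj h) - (q * (h * adj h)) * q)"
        by (simp add: g_def adj_diff adj_mult adj_adj q(2) left_diff_distrib right_diff_distrib mult.assoc)
      then have "adj g = 0" unfolding q(4) by (metis adj_mult_eq_0_iff diff_self)
      then show ?thesis by (simp add: g_def)
    qed
    have qx: "q * x = h"
      using qh qe by (simp add: h_def right_diff_distrib flip: mult.assoc)
    have "(e + q) * y = y" if "y \<in> F" for y
      using e(4)[OF that] qe by (metis add.right_neutral distrib_right mult.assoc mult_zero_left)
    moreover have "(e + q) * x = x" by (simp add: distrib_right qx h_def)
    moreover have "(e + q) * (e + q) = e + q"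
      by (simp add: distrib_left distrib_right e(3) q(3) qe eq)
    ultimately show ?case
      using e q subspace_add[OF sub] by (intro bexI[of _ "e + q"]) (auto simp: adj_add)
  qed
  obtain B where B: "finite B" "independent B" "B \<subseteq> K" "span B = K"
    using finite_basis[OF sub K(2,3)] .
  then obtain e where e: "e \<in> K" "adj e = e" "\<And>x. x \<in> B \<Longrightarrow> e * x = x"
    using *[of B] by blast
  have "x \<in> span B \<Longrightarrow> e * x = x" for x
    by (induction rule: span_induct_alt) (simp_all add: distrib_left e(3))
  then have l: "e * x = x" if "x \<in> K" for x using that B by simp
  have "x * e = x" if "x \<in> K" for x
    using arg_cong[OF l[OF adj[OF that]], of adj] e(2) by (simp add: adj_mult adj_adj)
  with e l that show thesis by blast
qed

text \<open>
  In finite dimension an injective \<open>\<rho>\<close> is bounded below by some constant.  For the self-adjoint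
  \<open>h = x\<^sup>* x\<close> the norm is multiplicative on the powers \<open>h\<^bsup>2^n\<^esup>\<close>, and letting \<open>n\<close> grow replaces that
  constant by \<open>1\<close>.
\<close>
lemma (in star_hom) norm_le_norm_hom_if_injective:
  assumes A: "star_subalgebra A" "A \<subseteq> span Y" "finite Y"
    and inj: "\<And>x. x \<in> A \<Longrightarrow> \<rho> x = 0 \<Longrightarrow> x = 0" and x: "x \<in> A"
  shows "norm x \<le> norm (\<rho> x)"
proof -
  have sub: "subspace A" and mult: "\<And>x y. x \<in> A \<Longrightarrow> y \<in> A \<Longrightarrow> x * y \<in> A"
    and adj: "\<And>x. x \<in> A \<Longrightarrow> adj x \<in> A"
    using A(1) by (auto simp: star_subalgebra_def)
  obtain B where B: "finite B" "span B = A"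
    using finite_basis[OF sub A(2,3)] by metis
  then obtain C where C: "\<And>x. x \<in> A \<Longrightarrow> norm x \<le> C * norm (\<rho> x)"
    using injective_on_span_bounded_below[OF B(1) linear_hom] inj by metis
  define h where "h = adj x * x"
  have pow: "\<exists>y\<in>A. adj y = y \<and> norm y = norm h ^ 2 ^ n \<and> norm (\<rho> y) = norm (\<rho> h) ^ 2 ^ n" for n
  proof (induction n)
    case 0
    show ?case using x mult adj by (intro bexI[of _ h]) (auto simp: h_def adj_mult adj_adj)
  next
    case (Suc n)
    then obtain y where y: "y \<in> A" "adj y = y" "norm y = norm h ^ 2 ^ n"
      "norm (\<rho> y) = norm (\<rho> h) ^ 2 ^ n" by blast
    have "norm (y * y) = (norm y)\<^sup>2" "norm (\<rho> (y * y)) = (norm (\<rho> y))\<^sup>2"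
      using norm_adj_mult[of y] norm_adj_mult[of "\<rho> y"] y(2) by (simp_all add: hom_mult flip: hom_adj)
    moreover have "r ^ 2 ^ Suc n = (r ^ 2 ^ n)\<^sup>2" for r :: real
      by (simp add: power_even_eq)
    ultimately show ?case
      using y mult by (intro bexI[of _ "y * y"]) (auto simp: adj_mult)
  qed
  have le: "norm h ^ 2 ^ n \<le> C * norm (\<rho> h) ^ 2 ^ n" for n
    using pow[of n] C by metis
  have "norm h \<le> norm (\<rho> h)"
  proof (rule ccontr)
    assume less: "\<not> norm h \<le> norm (\<rho> h)"
    have "h \<in> A" using x mult adj by (simp add: h_def)
    with less have pos: "norm (\<rho> h) > 0" using inj[of h] by auto
    define r where "r = norm h / norm (\<rho> h)"
    have r: "r > 1" using less pos by (simp add: r_def)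
    obtain n where "C < r ^ n" using real_arch_pow[OF r] by blast
    also have "r ^ n \<le> r ^ 2 ^ n" using r by (intro power_increasing) (auto intro: less_imp_le)
    also have "r ^ 2 ^ n \<le> C" using le[of n] pos by (simp add: r_def power_divide field_simps)
    finally show False by simp
  qed
  then have "(norm x)\<^sup>2 \<le> (norm (\<rho> x))\<^sup>2"
    by (simp add: h_def norm_adj_mult hom_mult hom_adj)
  then show ?thesis by (simp add: power2_le_iff_abs_le)
qed

text \<open>
  The kernel of \<open>\<rho>\<close> in \<open>A\<close> has a unit \<open>e\<close>, which is central in \<open>A\<close>.  On the complementary ideal
  \<open>L = A (1 - e)\<close> the map \<open>\<rho>\<close> is injective, hence isometric, and \<open>k = a e\<close> is the required element.
\<close>
lemma (in star_hom) ex_kernel_approximation: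
  assumes A: "star_subalgebra A" "A \<subseteq> span Y" "finite Y" and a: "a \<in> A"
  obtains k where "k \<in> A" and "\<rho> k = 0" and "norm (a - k) \<le> norm (\<rho> a)"
proof -
  have sub: "subspace A" and mult: "\<And>x y. x \<in> A \<Longrightarrow> y \<in> A \<Longrightarrow> x * y \<in> A"
    and adj: "\<And>x. x \<in> A \<Longrightarrow> adj x \<in> A"
    using A(1) by (auto simp: star_subalgebra_def)
  define K where "K = {x \<in> A. \<rho> x = 0}"
  have "star_subalgebra K"
    using sub mult adj unfolding K_def star_subalgebra_def subspace_def
    by (auto simp: hom_zero hom_add hom_scaleR hom_mult hom_adj)
  moreover have "K \<subseteq> span Y" using A by (auto simp: K_def)
  ultimately obtain e where e: "e \<in> K" "adj e = e" "\<And>x. x \<in> K \<Longrightarrow> e * x = x" "\<And>x. x \<in> K \<Longrightarrow> x * e = x"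
    using ex_unit_of_finite_dimensional[OF _ _ A(3)] by metis
  have ideal: "x * e \<in> K" "e * x \<in> K" if "x \<in> A" for x
    using that e(1) mult by (auto simp: K_def hom_mult)
  have central: "e * x = x * e" if "x \<in> A" for x
    using e(3)[OF ideal(1)[OF that]] e(4)[OF ideal(2)[OF that]] by (simp add: mult.assoc)
  define L where "L = {x \<in> A. x * e = 0}"
  have "star_subalgebra L"
    unfolding star_subalgebra_def
  proof (intro conjI ballI)
    show "subspace L"
      using sub unfolding L_def subspace_def by (auto simp: distrib_right)
    show "x * y \<in> L" if "x \<in> L" "y \<in> L" for x y
      using that mult by (auto simp: L_def mult.assoc)
    show "adj x \<in> L" if "x \<in> L" for x
    proof -
      have "e * x = 0" using that central by (auto simp: L_def)
      then have "adj x * e = 0" by (metis adj_mult adj_zero e(2))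
      with that adj show ?thesis by (simp add: L_def)
    qed
  qed
  moreover have "L \<subseteq> span Y" using A by (auto simp: L_def)
  moreover have "x = 0" if "x \<in> L" "\<rho> x = 0" for x
    using that e(4)[of x] by (auto simp: L_def K_def)
  moreover have "a - a * e \<in> L"
    using a mult e(4)[OF e(1)] ideal(1)[OF a] subspace_diff[OF sub]
    by (auto simp: L_def K_def left_diff_distrib mult.assoc)
  ultimately have "norm (a - a * e) \<le> norm (\<rho> (a - a * e))"
    using norm_le_norm_hom_if_injective[OF _ _ A(3)] by blast
  moreover have "\<rho> (a * e) = 0" using ideal(1)[OF a] by (simp add: K_def)
  ultimately show thesis
    using that[of "a * e"] ideal(1)[OF a] by (simp add: K_def hom_diff)
qed


section \<open>Joins in quasi-lattice ordered groups\<close>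

text \<open>
  Unlike \<open>qlo_join\<close>, this relation also expresses that the join is finite.
\<close>
definition is_join :: "('g, 'x) monoid_scheme \<Rightarrow> 'g set \<Rightarrow> 'g \<Rightarrow> 'g \<Rightarrow> 'g \<Rightarrow> bool" where
  "is_join G P p q m \<longleftrightarrow> m \<in> P \<and> qlo_le G P p m \<and> qlo_le G P q m \<and>
     (\<forall>w\<in>P. qlo_le G P p w \<and> qlo_le G P q w \<longrightarrow> qlo_le G P m w)"

definition join_closed :: "('g, 'x) monoid_scheme \<Rightarrow> 'g set \<Rightarrow> 'g set \<Rightarrow> bool" where
  "join_closed G P D \<longleftrightarrow> D \<subseteq> P \<and> (\<forall>p\<in>D. \<forall>q\<in>D. \<forall>m. is_join G P p q m \<longrightarrow> m \<in> D)"

context quasi_lattice_ordered_group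
begin

lemma P_carrier: "p \<in> P \<Longrightarrow> p \<in> carrier G"
  using P_subset by blast

lemma one_in_P: "\<one> \<in> P"
  using P_Int_inverse by blast

lemma qlo_le_refl: "p \<in> carrier G \<Longrightarrow> qlo_le G P p p"
  by (simp add: qlo_le_def one_in_P)

lemma inv_mult_cancel:
  assumes "p \<in> carrier G" "q \<in> carrier G" "r \<in> carrier G"
  shows "inv (p \<otimes> q) \<otimes> (p \<otimes> r) = inv q \<otimes> r"
proof -
  have "inv (p \<otimes> q) \<otimes> (p \<otimes> r) = inv q \<otimes> (inv p \<otimes> (p \<otimes> r))"
    using assms by (simp add: inv_mult_group m_assoc)
  also have "inv p \<otimes> (p \<otimes> r) = r"
    using assms by (simp add: m_assoc[symmetric])
  finally show ?thesis .
qed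

lemma qlo_le_mult_left_iff:
  assumes "p \<in> carrier G" "q \<in> carrier G" "r \<in> carrier G"
  shows "qlo_le G P (p \<otimes> q) (p \<otimes> r) \<longleftrightarrow> qlo_le G P q r"
  using inv_mult_cancel[OF assms] by (simp add: qlo_le_def)

lemma qlo_le_trans:
  assumes "p \<in> carrier G" "q \<in> carrier G" "r \<in> carrier G" "qlo_le G P p q" "qlo_le G P q r"
  shows "qlo_le G P p r"
proof -
  have "inv p \<otimes> r = (inv p \<otimes> q) \<otimes> (inv q \<otimes> r)"
    using assms(1-3) by (simp add: m_assoc) (simp add: m_assoc[symmetric])
  then show ?thesis
    using assms P_mult_closed by (simp add: qlo_le_def)
qed

lemma qlo_le_antisym:
  assumes "p \<in> carrier G" "q \<in> carrier G" "qlo_le G P p q" "qlo_le G P q p"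
  shows "p = q"
proof -
  have "inv (inv q \<otimes> p) = inv p \<otimes> q"
    using assms(1,2) by (simp add: inv_mult_group)
  then have "inv p \<otimes> q \<in> P \<inter> (\<lambda>p. inv p) ` P"
    using assms(3,4) unfolding qlo_le_def by (metis IntI imageI)
  then have "inv p \<otimes> q = \<one>"
    by (simp add: P_Int_inverse)
  then show ?thesis
    using assms(1,2) by (metis inv_equality inv_inv inv_closed)
qed

lemma qlo_le_mult:
  assumes "p \<in> P" "q \<in> P"
  shows "qlo_le G P p (p \<otimes> q)"
  using assms P_carrier by (simp add: qlo_le_def m_assoc[symmetric])

lemma is_join_unique: "is_join G P p q m \<Longrightarrow> is_join G P p q n \<Longrightarrow> m = n"
  unfolding is_join_def by (meson P_carrier qlo_le_antisym)

lemma is_join_commute: "is_join G P p q m \<Longrightarrow> is_join G P q p m"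
  by (auto simp: is_join_def)

lemma ex_is_join:
  assumes "p \<in> P" "q \<in> P" "u \<in> P" "qlo_le G P p u" "qlo_le G P q u"
  obtains m where "is_join G P p q m"
  using ex_least_upper_bound[of p q u] assms P_carrier unfolding is_join_def qlo_le_def by blast

lemma is_join_of_le: "p \<in> P \<Longrightarrow> q \<in> P \<Longrightarrow> qlo_le G P p q \<Longrightarrow> is_join G P p q q"
  using qlo_le_refl P_carrier by (auto simp: is_join_def)

lemma qlo_join_eq: "is_join G P p q m \<Longrightarrow> qlo_join G P p q = m"
  unfolding qlo_join_def
  by (rule the_equality) (use is_join_unique in \<open>auto simp: is_join_def\<close>)

lemma is_join_iff:
  assumes "p \<in> P" "q \<in> P"
  shows "is_join G P p q m \<longleftrightarrow> has_upper_bound G P p q \<and> m = qlo_join G P p q"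
proof
  show "has_upper_bound G P p q \<and> m = qlo_join G P p q" if "is_join G P p q m"
    using that qlo_join_eq[OF that] by (auto simp: has_upper_bound_def is_join_def)
  show "is_join G P p q m" if "has_upper_bound G P p q \<and> m = qlo_join G P p q"
    using that assms ex_is_join qlo_join_eq unfolding has_upper_bound_def by metis
qed

lemma is_join_mult_left:
  assumes "p \<in> P" "q \<in> P" "r \<in> P" "is_join G P (p \<otimes> q) (p \<otimes> r) (p \<otimes> m)" and m: "m \<in> P"
  shows "is_join G P q r m"
proof -
  have "qlo_le G P m w" if w: "w \<in> P" "qlo_le G P q w" "qlo_le G P r w" for w
  proof -
    have "qlo_le G P (p \<otimes> m) (p \<otimes> w)"
      using assms w P_mult_closed[of p w] unfolding is_join_def
      by (metis P_carrier qlo_le_mult_left_iff)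
    then show ?thesis using assms w by (metis P_carrier qlo_le_mult_left_iff)
  qed
  then show ?thesis
    using assms m unfolding is_join_def by (metis P_carrier qlo_le_mult_left_iff)
qed

text \<open>The join \<open>n\<close> bounds \<open>q\<close> and \<open>r\<close>, which is why their join \<open>k\<close> exists.\<close>
lemma is_join_assoc:
  assumes "p \<in> P" "q \<in> P" "r \<in> P" "is_join G P p q m" "is_join G P m r n"
  obtains k where "is_join G P q r k" and "is_join G P p k n"
proof -
  have n: "n \<in> P" "qlo_le G P p n" "qlo_le G P q n" "qlo_le G P r n"
    using assms unfolding is_join_def by (meson P_carrier qlo_le_trans)+
  then obtain k where k: "is_join G P q r k"
    using assms ex_is_join by blast
  have "is_join G P p k n"
    unfolding is_join_def
  proof (intro conjI ballI impI)
    show "qlo_le G P k n" using k n by (auto simp: is_join_def)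
    fix w assume w: "w \<in> P" "qlo_le G P p w \<and> qlo_le G P k w"
    then have "qlo_le G P q w" "qlo_le G P r w"
      using k assms unfolding is_join_def by (meson P_carrier qlo_le_trans)+
    then show "qlo_le G P n w"
      using w assms unfolding is_join_def by blast
  qed (use n in auto)
  with k that show thesis by blast
qed

text \<open>
  One round of joins with \<open>q\<close> suffices, since \<open>(q \<or> c) \<or> d = q \<or> (c \<or> d)\<close> and \<open>(q \<or> c) \<or> q = q \<or> c\<close>.
\<close>
lemma join_closed_insert:
  assumes D: "join_closed G P D" and q: "q \<in> P"
  shows "join_closed G P (insert q D \<union> {m. \<exists>d\<in>D. is_join G P q d m})"
proof -
  let ?D = "insert q D \<union> {m. \<exists>d\<in>D. is_join G P q d m}"
  have DP: "D \<subseteq> P"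
    using D unfolding join_closed_def by (rule conjunct1)
  have Dj: "m \<in> D" if "c \<in> D" "d \<in> D" "is_join G P c d m" for c d m
    using conjunct2[OF D[unfolded join_closed_def]] that by blast
  have P: "?D \<subseteq> P" using DP q by (auto simp: is_join_def)
  have qd: "m \<in> ?D" if "d \<in> D" "is_join G P q d m" for d m using that by blast
  have D1: "m \<in> ?D" if step: "x \<in> ?D" "d \<in> D" "is_join G P x d m" for x d m
  proof -
    consider "x = q" | "x \<in> D" | c where "c \<in> D" "is_join G P q c x" using \<open>x \<in> ?D\<close> by blast
    then show ?thesis
    proof cases
      case 3
      then obtain k where "is_join G P c d k" "is_join G P q k m"
        using is_join_assoc[of q c d x m] step q DP by blast
      then show ?thesis using Dj[of c d k] 3 step by blast
    qed (use step Dj in blast)+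
  qed
  have qq: "m \<in> ?D" if step: "x \<in> ?D" "is_join G P x q m" for x m
  proof -
    consider "x = q" | "x \<in> D" | c where "c \<in> D" "is_join G P q c x" using \<open>x \<in> ?D\<close> by blast
    then show ?thesis
    proof cases
      case 1
      then have "m = q"
        using step q is_join_of_le is_join_unique qlo_le_refl P_carrier by metis
      then show ?thesis by simp
    next
      case 2
      then show ?thesis using step is_join_commute by blast
    next
      case 3
      have "qlo_le G P q x" "x \<in> P" using 3 by (auto simp: is_join_def)
      then have "m = x"
        using step q is_join_of_le is_join_unique is_join_commute by metis
      then show ?thesis using step by simp
    qed
  qed
  have "m \<in> ?D" if step: "x \<in> ?D" "y \<in> ?D" "is_join G P x y m" for x y m
  proof -
    consider "y = q" | "y \<in> D" | d where "d \<in> D" "is_join G P q d y" using \<open>y \<in> ?D\<close> by blast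
    then show ?thesis
    proof cases
      case 3
      have yx: "is_join G P d q y" "is_join G P y x m"
        using 3 step is_join_commute by blast+
      have xP: "x \<in> P" "d \<in> P" using step P 3 DP by blast+
      obtain k where k: "is_join G P q x k" "is_join G P d k m"
        using is_join_assoc[OF xP(2) q xP(1) yx] .
      then have "k \<in> ?D" using qq[of x k] step is_join_commute by blast
      then show ?thesis using D1[of k d m] k 3 is_join_commute by blast
    qed (use step qq D1 in blast)+
  qed
  with P show ?thesis unfolding join_closed_def by blast
qed

lemma ex_finite_join_closed:
  assumes "finite F" "F \<subseteq> P"
  obtains D where "finite D" and "F \<subseteq> D" and "join_closed G P D"
proof -
  from assms have "\<exists>D. finite D \<and> F \<subseteq> D \<and> join_closed G P D"
  proof induction
    case empty
    then show ?case by (intro exI[of _ "{}"]) (auto simp: join_closed_def)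
  next
    case (insert q F)
    then obtain D where D: "finite D" "F \<subseteq> D" "join_closed G P D" by auto
    have "{m. \<exists>d\<in>D. is_join G P q d m} \<subseteq> (\<lambda>d. qlo_join G P q d) ` D"
      using qlo_join_eq by blast
    then have "finite {m. \<exists>d\<in>D. is_join G P q d m}"
      using D(1) finite_surj by blast
    with D insert.prems join_closed_insert[OF D(3), of q] show ?case
      by (intro exI[of _ "insert q D \<union> {m. \<exists>d\<in>D. is_join G P q d m}"]) auto
  qed
  with that show thesis by blast
qed

lemma ex_minimal:
  assumes "finite D" "D \<subseteq> P" "D \<noteq> {}"
  obtains p where "p \<in> D" and "\<And>q. q \<in> D \<Longrightarrow> qlo_le G P q p \<Longrightarrow> q = p"
proof -
  let ?R = "\<lambda>p q. qlo_le G P p q \<and> p \<noteq> q"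
  have D: "q \<in> carrier G" if "q \<in> D" for q
    using that assms(2) P_carrier by blast
  have "asymp_on D ?R"
    by (rule asymp_onI) (use D qlo_le_antisym in blast)
  moreover have "transp_on D ?R"
  proof (rule transp_onI)
    fix x y z assume *: "x \<in> D" "y \<in> D" "z \<in> D" "?R x y" "?R y z"
    then have "qlo_le G P x z" using D qlo_le_trans[of x y z] by blast
    moreover have "x \<noteq> z" using * D qlo_le_antisym[of x y] by blast
    ultimately show "?R x z" by blast
  qed
  ultimately show thesis
    using Finite_Set.bex_min_element[OF assms(1) _ _ assms(3), of ?R] that by blast
qed

text \<open>
  A join of \<open>q\<close> and \<open>r\<close> that equals \<open>p\<close> forces \<open>r \<le> p\<close>, hence \<open>r = p\<close> by minimality.  This makes the
  span of the remaining degrees an ideal.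
\<close>
lemma join_absorbing_of_minimal:
  assumes "join_closed G P D" and "\<And>q. q \<in> D \<Longrightarrow> qlo_le G P q p \<Longrightarrow> q = p"
    and "q \<in> D" and "r \<in> D - {p}" and "is_join G P q r m \<or> is_join G P r q m"
  shows "m \<in> D - {p}"
  using assms unfolding join_closed_def is_join_def by blast

lemma join_closed_remove_minimal:
  assumes "join_closed G P D" and "\<And>q. q \<in> D \<Longrightarrow> qlo_le G P q p \<Longrightarrow> q = p"
  shows "join_closed G P (D - {p})"
  unfolding join_closed_def
proof (intro conjI ballI allI impI)
  show "D - {p} \<subseteq> P" using assms(1) unfolding join_closed_def by blast
  fix q r m assume "q \<in> D - {p}" "r \<in> D - {p}" "is_join G P q r m"
  then show "m \<in> D - {p}"
    using join_absorbing_of_minimal[OF assms, of q r m] by blast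
qed

end


section \<open>Common extensions of paths\<close>

text \<open>
  The index set of the sum in the product formula for a representation.
\<close>
definition extension_pairs ::
  "('g, 'x) monoid_scheme \<Rightarrow> 'g set \<Rightarrow> ('m, 'g) graph_data \<Rightarrow> 'm \<Rightarrow> 'm \<Rightarrow> ('m \<times> 'm) set" where
  "extension_pairs G P \<Lambda> \<nu> \<xi> =
    {(\<alpha>, \<beta>). \<alpha> \<in> paths_to \<Lambda> (src \<Lambda> \<nu>) \<and> \<beta> \<in> paths_to \<Lambda> (src \<Lambda> \<xi>) \<and>
             cmp \<Lambda> \<nu> \<alpha> = cmp \<Lambda> \<xi> \<beta> \<and> cmp \<Lambda> \<nu> \<alpha> \<in> MCE G P \<Lambda> \<nu> \<xi>}"

context P_graph
begin

lemma paths_toD: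
  assumes "\<alpha> \<in> paths_to \<Lambda> v"
  shows "\<alpha> \<in> Mor \<Lambda>" and "rng \<Lambda> \<alpha> = v"
  using assms by (auto simp: paths_to_def)

lemma cmp_path:
  assumes "\<mu> \<in> Mor \<Lambda>" "\<alpha> \<in> paths_to \<Lambda> (src \<Lambda> \<mu>)"
  shows "cmp \<Lambda> \<mu> \<alpha> \<in> Mor \<Lambda>" "src \<Lambda> (cmp \<Lambda> \<mu> \<alpha>) = src \<Lambda> \<alpha>" "rng \<Lambda> (cmp \<Lambda> \<mu> \<alpha>) = rng \<Lambda> \<mu>"
    "deg \<Lambda> (cmp \<Lambda> \<mu> \<alpha>) = deg \<Lambda> \<mu> \<otimes> deg \<Lambda> \<alpha>"
  using assms paths_toD[OF assms(2)] by (simp_all add: cmp_closed src_cmp rng_cmp deg_cmp)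

lemma deg_carrier: "x \<in> Mor \<Lambda> \<Longrightarrow> deg \<Lambda> x \<in> carrier G"
  by (simp add: P_carrier deg_closed)

lemma src_path: "\<mu> \<in> Mor \<Lambda> \<Longrightarrow> src \<Lambda> \<mu> \<in> paths_to \<Lambda> (src \<Lambda> \<mu>)"
  by (simp add: paths_to_def src_closed rng_src)

lemma cmp_cancel:
  assumes \<mu>: "\<mu> \<in> Mor \<Lambda>" "\<alpha> \<in> paths_to \<Lambda> (src \<Lambda> \<mu>)" and \<mu>': "\<mu>' \<in> Mor \<Lambda>" "\<alpha>' \<in> paths_to \<Lambda> (src \<Lambda> \<mu>')"
    and eq: "cmp \<Lambda> \<mu> \<alpha> = cmp \<Lambda> \<mu>' \<alpha>'" and deg: "deg \<Lambda> \<mu> = deg \<Lambda> \<mu>'"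
  shows "\<mu> = \<mu>'" and "\<alpha> = \<alpha>'"
proof -
  have m: "\<alpha> \<in> Mor \<Lambda>" "\<alpha>' \<in> Mor \<Lambda>" using \<mu> \<mu>' paths_toD by blast+
  have "deg \<Lambda> \<mu> \<otimes> deg \<Lambda> \<alpha> = deg \<Lambda> \<mu> \<otimes> deg \<Lambda> \<alpha>'"
    using arg_cong[OF eq, of "deg \<Lambda>"] deg cmp_path(4)[OF \<mu>] cmp_path(4)[OF \<mu>'] by simp
  then have deg': "deg \<Lambda> \<alpha> = deg \<Lambda> \<alpha>'"
    using m \<mu> by (simp add: deg_carrier)
  have "(\<mu>, \<alpha>) = (\<mu>', \<alpha>')"
    using factorisation[OF cmp_path(1)[OF \<mu>] deg_closed[OF \<mu>(1)] deg_closed[OF m(1)] cmp_path(4)[OF \<mu>]]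
    by (rule ex1E) (use \<mu> \<mu>' m eq deg deg' paths_toD(2) in \<open>metis fst_conv snd_conv\<close>)
  then show "\<mu> = \<mu>'" and "\<alpha> = \<alpha>'" by simp_all
qed

lemma deg_one_imp_vertex:
  assumes "x \<in> Mor \<Lambda>" "deg \<Lambda> x = \<one>"
  shows "x = rng \<Lambda> x"
proof (rule cmp_cancel(1))
  show "cmp \<Lambda> x (src \<Lambda> x) = cmp \<Lambda> (rng \<Lambda> x) x"
    using assms by (simp add: cmp_src cmp_rng)
qed (use assms in \<open>simp_all add: src_closed rng_src rng_closed deg_rng paths_to_def src_rng\<close>)

lemma MCE_iff:
  assumes "\<mu> \<in> Mor \<Lambda>" "\<nu> \<in> Mor \<Lambda>"
  shows "x \<in> MCE G P \<Lambda> \<mu> \<nu> \<longleftrightarrow> x \<in> Mor \<Lambda> \<and> is_join G P (deg \<Lambda> \<mu>) (deg \<Lambda> \<nu>) (deg \<Lambda> x) \<and>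
    (\<exists>\<alpha>\<in>paths_to \<Lambda> (src \<Lambda> \<mu>). x = cmp \<Lambda> \<mu> \<alpha>) \<and> (\<exists>\<beta>\<in>paths_to \<Lambda> (src \<Lambda> \<nu>). x = cmp \<Lambda> \<nu> \<beta>)"
  using assms by (auto simp: MCE_def is_join_iff deg_closed)

lemma extension_pairs_iff:
  assumes "\<nu> \<in> Mor \<Lambda>" "\<xi> \<in> Mor \<Lambda>"
  shows "(\<alpha>, \<beta>) \<in> extension_pairs G P \<Lambda> \<nu> \<xi> \<longleftrightarrow>
    \<alpha> \<in> paths_to \<Lambda> (src \<Lambda> \<nu>) \<and> \<beta> \<in> paths_to \<Lambda> (src \<Lambda> \<xi>) \<and>
    cmp \<Lambda> \<nu> \<alpha> = cmp \<Lambda> \<xi> \<beta> \<and> is_join G P (deg \<Lambda> \<nu>) (deg \<Lambda> \<xi>) (deg \<Lambda> (cmp \<Lambda> \<nu> \<alpha>))"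
  using assms by (auto simp: extension_pairs_def MCE_iff cmp_path(1))

lemma finite_extension_pairs:
  assumes "finitely_aligned G P \<Lambda>" "\<nu> \<in> Mor \<Lambda>" "\<xi> \<in> Mor \<Lambda>"
  shows "finite (extension_pairs G P \<Lambda> \<nu> \<xi>)"
proof (rule inj_on_finite)
  show "inj_on (\<lambda>(\<alpha>, \<beta>). cmp \<Lambda> \<nu> \<alpha>) (extension_pairs G P \<Lambda> \<nu> \<xi>)"
    unfolding extension_pairs_def inj_on_def using assms cmp_cancel(2) by fastforce
  show "(\<lambda>(\<alpha>, \<beta>). cmp \<Lambda> \<nu> \<alpha>) ` extension_pairs G P \<Lambda> \<nu> \<xi> \<subseteq> MCE G P \<Lambda> \<nu> \<xi>"
    by (auto simp: extension_pairs_def)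
  show "finite (MCE G P \<Lambda> \<nu> \<xi>)"
    using assms by (simp add: finitely_aligned_def)
qed

lemma extension_pairs_empty: "MCE G P \<Lambda> \<nu> \<xi> = {} \<Longrightarrow> extension_pairs G P \<Lambda> \<nu> \<xi> = {}"
  by (auto simp: extension_pairs_def)

lemma extension_pairs_same_degree:
  assumes "\<nu> \<in> Mor \<Lambda>" "\<xi> \<in> Mor \<Lambda>" "deg \<Lambda> \<nu> = deg \<Lambda> \<xi>" "\<nu> \<noteq> \<xi>"
  shows "extension_pairs G P \<Lambda> \<nu> \<xi> = {}"
  using assms cmp_cancel(1) by (fastforce simp: extension_pairs_def)

text \<open>
  The only minimal common extension of a path \<open>\<mu>\<alpha>\<close> and its initial segment \<open>\<mu>\<close> is \<open>\<mu>\<alpha>\<close> itself.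
\<close>
lemma extension_pairs_initial_segment:
  assumes \<mu>: "\<mu> \<in> Mor \<Lambda>" "\<alpha> \<in> paths_to \<Lambda> (src \<Lambda> \<mu>)"
  shows "extension_pairs G P \<Lambda> (cmp \<Lambda> \<mu> \<alpha>) \<mu> = {(src \<Lambda> \<alpha>, \<alpha>)}"
proof -
  note c = cmp_path[OF \<mu>]
  have \<alpha>: "\<alpha> \<in> Mor \<Lambda>" using \<mu>(2) by (rule paths_toD)
  have join: "is_join G P (deg \<Lambda> (cmp \<Lambda> \<mu> \<alpha>)) (deg \<Lambda> \<mu>) (deg \<Lambda> (cmp \<Lambda> \<mu> \<alpha>))"
    using \<mu> \<alpha> c(4)
    by (intro is_join_commute[OF is_join_of_le]) (simp_all add: deg_closed P_mult_closed qlo_le_mult)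
  have "cmp \<Lambda> (cmp \<Lambda> \<mu> \<alpha>) (src \<Lambda> \<alpha>) = cmp \<Lambda> \<mu> \<alpha>"
    using cmp_src[OF c(1)] c(2) by simp
  then have "(src \<Lambda> \<alpha>, \<alpha>) \<in> extension_pairs G P \<Lambda> (cmp \<Lambda> \<mu> \<alpha>) \<mu>"
    using \<mu> \<alpha> c join src_path[OF \<alpha>] by (simp add: extension_pairs_iff)
  moreover have "x = (src \<Lambda> \<alpha>, \<alpha>)" if x: "x \<in> extension_pairs G P \<Lambda> (cmp \<Lambda> \<mu> \<alpha>) \<mu>" for x
  proof -
    obtain \<alpha>' \<beta>' where x': "x = (\<alpha>', \<beta>')" by (cases x)
    have p: "\<alpha>' \<in> paths_to \<Lambda> (src \<Lambda> (cmp \<Lambda> \<mu> \<alpha>))" "\<beta>' \<in> paths_to \<Lambda> (src \<Lambda> \<mu>)"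
      "cmp \<Lambda> (cmp \<Lambda> \<mu> \<alpha>) \<alpha>' = cmp \<Lambda> \<mu> \<beta>'"
      "is_join G P (deg \<Lambda> (cmp \<Lambda> \<mu> \<alpha>)) (deg \<Lambda> \<mu>) (deg \<Lambda> (cmp \<Lambda> (cmp \<Lambda> \<mu> \<alpha>) \<alpha>'))"
      using x unfolding x' extension_pairs_iff[OF c(1) \<mu>(1)] by blast+
    have \<alpha>': "\<alpha>' \<in> Mor \<Lambda>" using p(1) by (rule paths_toD)
    have "deg \<Lambda> (cmp \<Lambda> \<mu> \<alpha>) \<otimes> deg \<Lambda> \<alpha>' = deg \<Lambda> (cmp \<Lambda> \<mu> \<alpha>)"
      using is_join_unique[OF p(4) join] cmp_path(4)[OF c(1) p(1)] by simp
    then have "deg \<Lambda> \<alpha>' = \<one>"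
      using c(1) \<alpha>' by (simp add: deg_carrier)
    then have \<alpha>'_eq: "\<alpha>' = src \<Lambda> \<alpha>"
      using deg_one_imp_vertex[OF \<alpha>'] paths_toD(2)[OF p(1)] c(2) by simp
    have "cmp \<Lambda> \<mu> \<beta>' = cmp \<Lambda> \<mu> \<alpha>"
      using p(3) cmp_src[OF c(1)] c(2) \<alpha>'_eq by simp
    then have "\<beta>' = \<alpha>" using cmp_cancel(2) \<mu> p(2) by blast
    with \<alpha>'_eq x' show ?thesis by simp
  qed
  ultimately show ?thesis by blast
qed

text \<open>
  By cancellation and the left invariance of the order, every element of \<open>MCE(\<mu>\<alpha>, \<mu>\<xi>)\<close> is \<open>\<mu> y\<close> for some
  \<open>y\<close> in \<open>MCE(\<alpha>, \<xi>)\<close>.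
\<close>
lemma MCE_cmp_left_empty:
  assumes \<mu>: "\<mu> \<in> Mor \<Lambda>" "\<alpha> \<in> paths_to \<Lambda> (src \<Lambda> \<mu>)" "\<xi> \<in> paths_to \<Lambda> (src \<Lambda> \<mu>)"
    and "MCE G P \<Lambda> \<alpha> \<xi> = {}"
  shows "MCE G P \<Lambda> (cmp \<Lambda> \<mu> \<alpha>) (cmp \<Lambda> \<mu> \<xi>) = {}"
proof (rule ccontr)
  note c = cmp_path[OF \<mu>(1,2)] cmp_path[OF \<mu>(1,3)]
  have m: "\<alpha> \<in> Mor \<Lambda>" "\<xi> \<in> Mor \<Lambda>" "src \<Lambda> \<mu> = rng \<Lambda> \<alpha>" "src \<Lambda> \<mu> = rng \<Lambda> \<xi>"
    using \<mu> paths_toD by auto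
  assume "MCE G P \<Lambda> (cmp \<Lambda> \<mu> \<alpha>) (cmp \<Lambda> \<mu> \<xi>) \<noteq> {}"
  then obtain x where "x \<in> MCE G P \<Lambda> (cmp \<Lambda> \<mu> \<alpha>) (cmp \<Lambda> \<mu> \<xi>)"
    by blast
  then obtain \<gamma> \<delta> where x: "is_join G P (deg \<Lambda> (cmp \<Lambda> \<mu> \<alpha>)) (deg \<Lambda> (cmp \<Lambda> \<mu> \<xi>)) (deg \<Lambda> x)"
    "\<gamma> \<in> paths_to \<Lambda> (src \<Lambda> (cmp \<Lambda> \<mu> \<alpha>))" "x = cmp \<Lambda> (cmp \<Lambda> \<mu> \<alpha>) \<gamma>"
    "\<delta> \<in> paths_to \<Lambda> (src \<Lambda> (cmp \<Lambda> \<mu> \<xi>))" "x = cmp \<Lambda> (cmp \<Lambda> \<mu> \<xi>) \<delta>"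
    using c(1,5) by (metis MCE_iff)
  have \<gamma>: "\<gamma> \<in> paths_to \<Lambda> (src \<Lambda> \<alpha>)" and \<delta>: "\<delta> \<in> paths_to \<Lambda> (src \<Lambda> \<xi>)"
    using x c by simp_all
  define y where "y = cmp \<Lambda> \<alpha> \<gamma>"
  have y: "y \<in> paths_to \<Lambda> (src \<Lambda> \<mu>)" "cmp \<Lambda> \<xi> \<delta> \<in> paths_to \<Lambda> (src \<Lambda> \<mu>)"
    using \<gamma> \<delta> m by (auto simp: y_def paths_to_def cmp_closed rng_cmp)
  have "x = cmp \<Lambda> \<mu> y" "x = cmp \<Lambda> \<mu> (cmp \<Lambda> \<xi> \<delta>)"
    using x(3,5) \<mu> m paths_toD[OF \<gamma>] paths_toD[OF \<delta>] by (simp_all add: y_def cmp_assoc)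
  then have "y = cmp \<Lambda> \<xi> \<delta>" and deg: "deg \<Lambda> x = deg \<Lambda> \<mu> \<otimes> deg \<Lambda> y"
    using cmp_cancel(2) \<mu> y cmp_path(4) by blast+
  moreover have "is_join G P (deg \<Lambda> \<alpha>) (deg \<Lambda> \<xi>) (deg \<Lambda> y)"
    using is_join_mult_left[of "deg \<Lambda> \<mu>"] x(1) c(4,8) deg m \<mu>(1) paths_toD(1)[OF y(1)]
    by (simp add: deg_closed)
  ultimately have "y \<in> MCE G P \<Lambda> \<alpha> \<xi>"
    using \<gamma> \<delta> paths_toD(1)[OF y(1)] y_def unfolding MCE_iff[OF m(1,2)] by blast
  with assms(4) show False by simp
qed

end


section \<open>Products and finitely generated algebras\<close>

lemma mult_list_Cons: "xs \<noteq> [] \<Longrightarrow> mult_list (x # xs) = x * mult_list xs"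
  by (cases xs) auto

lemma mult_list_absorb_right:
  "xs \<noteq> [] \<Longrightarrow> (\<And>x. x \<in> set xs \<Longrightarrow> x * y = x) \<Longrightarrow> mult_list xs * y = mult_list xs"
  by (induction xs rule: list_nonempty_induct) (simp_all add: mult_list_Cons mult.assoc)

lemma mult_list_fix:
  "xs \<noteq> [] \<Longrightarrow> (\<And>x. x \<in> set xs \<Longrightarrow> x * y = y) \<Longrightarrow> mult_list xs * y = y"
  by (induction xs rule: list_nonempty_induct) (simp_all add: mult_list_Cons mult.assoc)

lemma mult_list_commute:
  "(\<And>z. z \<in> set xs \<Longrightarrow> x * z = z * x) \<Longrightarrow> x * mult_list xs = mult_list xs * x"
proof (induction xs rule: mult_list.induct)
  case (3 y z zs)
  have "x * (y * mult_list (z # zs)) = y * (x * mult_list (z # zs))"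
    using 3(2)[of y] by (simp flip: mult.assoc)
  then show ?case
    using 3 by (simp add: mult.assoc)
qed auto

lemma mult_list_kill:
  assumes "\<And>u v. u \<in> set xs \<Longrightarrow> v \<in> set xs \<Longrightarrow> u * v = v * u" and "x \<in> set xs" and "x * y = 0"
  shows "mult_list xs * y = 0"
  using assms
proof (induction xs rule: mult_list.induct)
  case (3 u z zs)
  show ?case
  proof (cases "x = u")
    case True
    have "u * mult_list (z # zs) = mult_list (z # zs) * u"
      using 3(2) by (intro mult_list_commute) simp
    then show ?thesis using True 3(4) by (simp add: mult.assoc)
  next
    case False
    then have "mult_list (z # zs) * y = 0" using 3 by simp
    then show ?thesis by (simp add: mult.assoc)
  qed
qed auto

lemma (in star_hom) hom_mult_list: "\<rho> (mult_list xs) = mult_list (map \<rho> xs)"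
  by (induction xs rule: mult_list.induct) (simp_all add: hom_zero hom_mult)

lemma (in star_hom) hom_commuting_prod: "\<rho> (commuting_prod f E) = commuting_prod (\<lambda>i. \<rho> (f i)) E"
  by (simp add: commuting_prod_def hom_mult_list comp_def)

lemma commuting_prod_cases:
  assumes "finite E"
  obtains xs where "set xs = E" and "commuting_prod f E = mult_list (map f xs)"
proof -
  have "\<exists>xs. distinct xs \<and> set xs = E"
    using finite_distinct_list[OF assms] by blast
  then have "set (SOME xs. distinct xs \<and> set xs = E) = E"
    by (rule someI2_ex) simp
  with that show thesis unfolding commuting_prod_def by blast
qed

lemma commuting_prod_cong:
  assumes "finite E" "\<And>i. i \<in> E \<Longrightarrow> f i = g i"
  shows "commuting_prod f E = commuting_prod g E"
proof -
  have "\<exists>xs. distinct xs \<and> set xs = E"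
    using finite_distinct_list[OF assms(1)] by blast
  then have "set (SOME xs. distinct xs \<and> set xs = E) = E"
    by (rule someI2_ex) simp
  then show ?thesis
    unfolding commuting_prod_def using assms(2) by (intro arg_cong[of _ _ mult_list] map_cong) auto
qed

definition subalgebra :: "'a::real_algebra set \<Rightarrow> bool" where
  "subalgebra A \<longleftrightarrow> subspace A \<and> (\<forall>x\<in>A. \<forall>y\<in>A. x * y \<in> A)"

lemma subalgebra_hull: "subalgebra (subalgebra hull X)"
  by (rule hull_in) (auto simp: subalgebra_def intro: subspace_Inter)

lemma subspace_mult_right_vimage: "subspace H \<Longrightarrow> subspace {m. m * x \<in> (H::'a::real_algebra set)}"
  by (auto simp: subspace_def distrib_right)

lemma subspace_mult_left_vimage: "subspace H \<Longrightarrow> subspace {m. x * m \<in> (H::'a::real_algebra set)}"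
  by (auto simp: subspace_def distrib_left)

text \<open>
  When the span \<open>M\<close> of \<open>T\<close> is an algebra, the algebra generated by \<open>T\<close> and \<open>X\<close> lies in \<open>M + H\<close>,
  where \<open>H\<close> is generated by the sandwiched elements \<open>x\<close>, \<open>t x\<close>, \<open>x t\<close>, \<open>t x t'\<close>: multiplying a product
  of such elements by \<open>M\<close> only changes its first or its last factor.
\<close>
lemma subalgebra_hull_Un:
  fixes T X :: "'a::real_algebra set"
  assumes M: "\<And>m m'. m \<in> span T \<Longrightarrow> m' \<in> span T \<Longrightarrow> m * m' \<in> span T"
  defines "Z \<equiv> X \<union> {t * x | t x. t \<in> T \<and> x \<in> X} \<union> {x * t | x t. x \<in> X \<and> t \<in> T} \<union>
    {t * x * t' | t x t'. t \<in> T \<and> x \<in> X \<and> t' \<in> T}"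
  assumes u: "u \<in> subalgebra hull (T \<union> X)"
  obtains m h where "m \<in> span T" and "h \<in> subalgebra hull Z" and "u = m + h"
proof -
  define H where "H = subalgebra hull Z"
  have H: "subspace H" "\<And>x y. x \<in> H \<Longrightarrow> y \<in> H \<Longrightarrow> x * y \<in> H"
    using subalgebra_hull[of Z] by (auto simp: H_def subalgebra_def)
  have ZH: "z \<in> H" if "z \<in> Z" for z
    using that by (simp add: H_def hull_inc)
  have Z: "x \<in> Z" "t \<in> T \<Longrightarrow> t * x \<in> Z" "t \<in> T \<Longrightarrow> x * t \<in> Z"
    "t \<in> T \<Longrightarrow> t' \<in> T \<Longrightarrow> t * x * t' \<in> Z" if "x \<in> X" for x t t'
    using that unfolding Z_def by blast+
  have Z_cases: thesis
    if "z \<in> Z" "z \<in> X \<Longrightarrow> thesis" "\<And>t x. t \<in> T \<Longrightarrow> x \<in> X \<Longrightarrow> z = t * x \<Longrightarrow> thesis"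
      "\<And>t x. t \<in> T \<Longrightarrow> x \<in> X \<Longrightarrow> z = x * t \<Longrightarrow> thesis"
      "\<And>t x t'. t \<in> T \<Longrightarrow> t' \<in> T \<Longrightarrow> x \<in> X \<Longrightarrow> z = t * x * t' \<Longrightarrow> thesis" for z thesis
    using that unfolding Z_def by blast
  have mx: "m * x \<in> H" if "m \<in> span T" "x \<in> X" for m x
  proof -
    have "span T \<subseteq> {m. m * x \<in> H}"
      using that(2) Z(2) ZH by (intro span_minimal subspace_mult_right_vimage H) auto
    with that show ?thesis by blast
  qed
  have xm: "x * m \<in> H" if "m \<in> span T" "x \<in> X" for m x
  proof -
    have "span T \<subseteq> {m. x * m \<in> H}"
      using that(2) Z(3) ZH by (intro span_minimal subspace_mult_left_vimage H) auto
    with that show ?thesis by blast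
  qed
  have mxt: "m * x * t \<in> H" if "m \<in> span T" "x \<in> X" "t \<in> T" for m x t
  proof -
    have "span T \<subseteq> {m. m * (x * t) \<in> H}"
      using that(2,3) Z(4) ZH
      by (intro span_minimal subspace_mult_right_vimage H) (auto simp flip: mult.assoc)
    with that show ?thesis by (auto simp: mult.assoc)
  qed
  have mxm: "m * x * m' \<in> H" if "m \<in> span T" "x \<in> X" "m' \<in> span T" for m x m'
  proof -
    have "span T \<subseteq> {m'. m * x * m' \<in> H}"
      using that(1,2) mxt by (intro span_minimal subspace_mult_left_vimage H) auto
    with that show ?thesis by blast
  qed
  have MH: "h \<in> H \<and> (\<forall>m\<in>span T. m * h \<in> H)" if "h \<in> H" for h
    using that[unfolded H_def]
  proof (rule hull_induct)
    fix z assume z: "z \<in> Z"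
    have "m * z \<in> H" if m: "m \<in> span T" for m
    proof -
      have mt: "m * t \<in> span T" if "t \<in> T" for t
        using M m that span_base by blast
      show ?thesis
        using z
      proof (rule Z_cases)
        show ?thesis if "z \<in> X" using mx m that by blast
        show ?thesis if "t \<in> T" "x \<in> X" "z = t * x" for t x
          using mx[OF mt] that by (simp add: mult.assoc)
        show ?thesis if "t \<in> T" "x \<in> X" "z = x * t" for t x
          using mxt[OF m] that by (simp add: mult.assoc)
        show ?thesis if "t \<in> T" "t' \<in> T" "x \<in> X" "z = t * x * t'" for t x t'
          using mxt[OF mt] that by (simp add: mult.assoc)
      qed
    qed
    with ZH[OF z] show "z \<in> H \<and> (\<forall>m\<in>span T. m * z \<in> H)" by blast
  next
    show "subalgebra {h. h \<in> H \<and> (\<forall>m\<in>span T. m * h \<in> H)}"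
      using H unfolding subalgebra_def subspace_def
      by (auto simp: distrib_left mult.assoc[symmetric])
  qed
  have HM: "h \<in> H \<and> (\<forall>m\<in>span T. h * m \<in> H)" if "h \<in> H" for h
    using that[unfolded H_def]
  proof (rule hull_induct)
    fix z assume z: "z \<in> Z"
    have "z * m \<in> H" if m: "m \<in> span T" for m
    proof -
      have mt: "t * m \<in> span T" if "t \<in> T" for t
        using M m that span_base by blast
      show ?thesis
        using z
      proof (rule Z_cases)
        show ?thesis if "z \<in> X" using xm m that by blast
        show ?thesis if "t \<in> T" "x \<in> X" "z = t * x" for t x
          using mxm[OF span_base _ m] that by simp
        show ?thesis if "t \<in> T" "x \<in> X" "z = x * t" for t x
          using xm[OF mt] that by (simp add: mult.assoc)
        show ?thesis if "t \<in> T" "t' \<in> T" "x \<in> X" "z = t * x * t'" for t x t'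
          using mxm[OF span_base _ mt] that by (simp add: mult.assoc)
      qed
    qed
    with ZH[OF z] show "z \<in> H \<and> (\<forall>m\<in>span T. z * m \<in> H)" by blast
  next
    show "subalgebra {h. h \<in> H \<and> (\<forall>m\<in>span T. h * m \<in> H)}"
      using H unfolding subalgebra_def subspace_def
      by (auto simp: distrib_right mult.assoc)
  qed
  define N where "N = {m + h | m h. m \<in> span T \<and> h \<in> H}"
  have "subspace N"
    unfolding N_def by (rule subspace_sums[OF subspace_span H(1)])
  moreover have "x * y \<in> N" if xy: "x \<in> N" "y \<in> N" for x y
  proof -
    obtain m h m' h' where *: "x = m + h" "y = m' + h'" "m \<in> span T" "m' \<in> span T" "h \<in> H" "h' \<in> H"
      using xy unfolding N_def by blast
    have "x * y = m * m' + (m * h' + h * m' + h * h')"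
      by (simp add: * distrib_left distrib_right)
    moreover have "m * h' + h * m' + h * h' \<in> H"
      using * MH HM H by (intro subspace_add[OF H(1)]) blast+
    ultimately show ?thesis using M * unfolding N_def by blast
  qed
  ultimately have "subalgebra N" by (simp add: subalgebra_def)
  moreover have "T \<union> X \<subseteq> N"
  proof
    fix x assume "x \<in> T \<union> X"
    then have "x \<in> span T \<or> x \<in> H"
      using span_base Z(1) ZH by blast
    then show "x \<in> N"
    proof
      assume "x \<in> span T"
      then have "x + 0 \<in> N" unfolding N_def using subspace_0[OF H(1)] by blast
      then show ?thesis by simp
    next
      assume "x \<in> H"
      then have "0 + x \<in> N" unfolding N_def using span_zero by blast
      then show ?thesis by simp
    qed
  qed
  ultimately have "u \<in> N"
    using u hull_minimal[of "T \<union> X" N subalgebra] by blast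
  with that show thesis unfolding N_def H_def by blast
qed


section \<open>Representations of \<open>\<Lambda> *\<^sub>d\<^sub>,\<^sub>s \<Lambda>\<close>\<close>

locale aligned_representation = P_graph G P \<Lambda>
  for G (structure) and P :: "'g set" and \<Lambda> :: "('m, 'g) graph_data" +
  fixes \<tau> :: "'m \<Rightarrow> 'm \<Rightarrow> 'a::cstar_algebra"
  assumes aligned: "finitely_aligned G P \<Lambda>"
    and representation: "ds_representation G P \<Lambda> type_cstar \<tau>"
begin

lemma ds_pairs_iff:
  "(\<mu>, \<nu>) \<in> ds_pairs \<Lambda> \<longleftrightarrow> \<mu> \<in> Mor \<Lambda> \<and> \<nu> \<in> Mor \<Lambda> \<and> src \<Lambda> \<mu> = src \<Lambda> \<nu> \<and> deg \<Lambda> \<mu> = deg \<Lambda> \<nu>"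
  by (simp add: ds_pairs_def)

lemma adj_rep: "(\<mu>, \<nu>) \<in> ds_pairs \<Lambda> \<Longrightarrow> adj (\<tau> \<mu> \<nu>) = \<tau> \<nu> \<mu>"
  using representation unfolding ds_representation_def by auto

lemma mult_rep:
  assumes "(\<mu>, \<nu>) \<in> ds_pairs \<Lambda>" "(\<xi>, \<eta>) \<in> ds_pairs \<Lambda>"
  shows "\<tau> \<mu> \<nu> * \<tau> \<xi> \<eta> = (\<Sum>(\<alpha>, \<beta>)\<in>extension_pairs G P \<Lambda> \<nu> \<xi>. \<tau> (cmp \<Lambda> \<mu> \<alpha>) (cmp \<Lambda> \<eta> \<beta>))"
proof -
  have "\<tau> \<mu> \<nu> * \<tau> \<xi> \<eta> =
      finsum type_cstar (\<lambda>(\<alpha>, \<beta>). \<tau> (cmp \<Lambda> \<mu> \<alpha>) (cmp \<Lambda> \<eta> \<beta>)) (extension_pairs G P \<Lambda> \<nu> \<xi>)"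
    using representation assms unfolding ds_representation_def extension_pairs_def by fastforce
  moreover have "finite (extension_pairs G P \<Lambda> \<nu> \<xi>)"
    using assms by (intro finite_extension_pairs aligned) (auto simp: ds_pairs_iff)
  ultimately show ?thesis by simp
qed

lemma extension_pairs_ds:
  assumes "(\<mu>, \<nu>) \<in> ds_pairs \<Lambda>" "(\<xi>, \<eta>) \<in> ds_pairs \<Lambda>" "(\<alpha>, \<beta>) \<in> extension_pairs G P \<Lambda> \<nu> \<xi>"
  shows "(cmp \<Lambda> \<mu> \<alpha>, cmp \<Lambda> \<eta> \<beta>) \<in> ds_pairs \<Lambda>"
    and "is_join G P (deg \<Lambda> \<mu>) (deg \<Lambda> \<xi>) (deg \<Lambda> (cmp \<Lambda> \<mu> \<alpha>))"
    and "\<alpha> \<in> paths_to \<Lambda> (src \<Lambda> \<mu>)"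
proof -
  have m: "\<mu> \<in> Mor \<Lambda>" "\<nu> \<in> Mor \<Lambda>" "\<xi> \<in> Mor \<Lambda>" "\<eta> \<in> Mor \<Lambda>" "src \<Lambda> \<mu> = src \<Lambda> \<nu>" "src \<Lambda> \<xi> = src \<Lambda> \<eta>"
    "deg \<Lambda> \<mu> = deg \<Lambda> \<nu>" "deg \<Lambda> \<xi> = deg \<Lambda> \<eta>"
    using assms(1,2) by (auto simp: ds_pairs_iff)
  have e: "\<alpha> \<in> paths_to \<Lambda> (src \<Lambda> \<nu>)" "\<beta> \<in> paths_to \<Lambda> (src \<Lambda> \<xi>)" "cmp \<Lambda> \<nu> \<alpha> = cmp \<Lambda> \<xi> \<beta>"
    "is_join G P (deg \<Lambda> \<nu>) (deg \<Lambda> \<xi>) (deg \<Lambda> (cmp \<Lambda> \<nu> \<alpha>))"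
    using assms(3) unfolding extension_pairs_iff[OF m(2,3)] by blast+
  show a: "\<alpha> \<in> paths_to \<Lambda> (src \<Lambda> \<mu>)" using e m by simp
  have b: "\<beta> \<in> paths_to \<Lambda> (src \<Lambda> \<eta>)" using e m by simp
  note c = cmp_path[OF m(1) a] cmp_path[OF m(4) b] cmp_path[OF m(2) e(1)] cmp_path[OF m(3) e(2)]
  show "(cmp \<Lambda> \<mu> \<alpha>, cmp \<Lambda> \<eta> \<beta>) \<in> ds_pairs \<Lambda>"
    unfolding ds_pairs_iff using c e(3) m by metis
  show "is_join G P (deg \<Lambda> \<mu>) (deg \<Lambda> \<xi>) (deg \<Lambda> (cmp \<Lambda> \<mu> \<alpha>))"
    using e(4) c m by metis
qed

lemma mult_rep_same_degree:
  assumes "(\<mu>, \<nu>) \<in> ds_pairs \<Lambda>" "(\<xi>, \<eta>) \<in> ds_pairs \<Lambda>" "deg \<Lambda> \<mu> = deg \<Lambda> \<xi>" "\<nu> \<noteq> \<xi>"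
  shows "\<tau> \<mu> \<nu> * \<tau> \<xi> \<eta> = 0"
  using assms extension_pairs_same_degree[of \<nu> \<xi>] by (simp add: mult_rep ds_pairs_iff)

lemma mult_rep_initial_segment_right:
  assumes "(\<kappa>, cmp \<Lambda> \<mu> \<alpha>) \<in> ds_pairs \<Lambda>" "(\<mu>, \<nu>) \<in> ds_pairs \<Lambda>" "\<alpha> \<in> paths_to \<Lambda> (src \<Lambda> \<mu>)"
  shows "\<tau> \<kappa> (cmp \<Lambda> \<mu> \<alpha>) * \<tau> \<mu> \<nu> = \<tau> \<kappa> (cmp \<Lambda> \<nu> \<alpha>)"
proof -
  have \<mu>: "\<mu> \<in> Mor \<Lambda>" using assms by (simp add: ds_pairs_iff)
  have "src \<Lambda> \<kappa> = src \<Lambda> \<alpha>" "\<kappa> \<in> Mor \<Lambda>"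
    using assms(1) cmp_path(2)[OF \<mu> assms(3)] by (simp_all add: ds_pairs_iff)
  then have "cmp \<Lambda> \<kappa> (src \<Lambda> \<alpha>) = \<kappa>" using cmp_src by metis
  then show ?thesis
    using mult_rep[OF assms(1,2)] extension_pairs_initial_segment[OF \<mu> assms(3)] by simp
qed

lemma mult_rep_initial_segment_left:
  assumes "(cmp \<Lambda> \<mu> \<alpha>, \<kappa>) \<in> ds_pairs \<Lambda>" "\<mu> \<in> Mor \<Lambda>" "\<alpha> \<in> paths_to \<Lambda> (src \<Lambda> \<mu>)"
  shows "\<tau> \<mu> \<mu> * \<tau> (cmp \<Lambda> \<mu> \<alpha>) \<kappa> = \<tau> (cmp \<Lambda> \<mu> \<alpha>) \<kappa>"
proof -
  have ds: "(\<kappa>, cmp \<Lambda> \<mu> \<alpha>) \<in> ds_pairs \<Lambda>" "(\<mu>, \<mu>) \<in> ds_pairs \<Lambda>"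
    using assms by (simp_all add: ds_pairs_iff)
  show ?thesis
    using arg_cong[OF mult_rep_initial_segment_right[OF ds assms(3)], of adj]
    by (simp add: adj_mult adj_rep ds)
qed

lemma mult_rep_compose:
  assumes "(\<kappa>, \<mu>) \<in> ds_pairs \<Lambda>" "(\<mu>, \<nu>) \<in> ds_pairs \<Lambda>"
  shows "\<tau> \<kappa> \<mu> * \<tau> \<mu> \<nu> = \<tau> \<kappa> \<nu>"
proof -
  have "\<mu> \<in> Mor \<Lambda>" "\<nu> \<in> Mor \<Lambda>" "src \<Lambda> \<nu> = src \<Lambda> \<mu>" using assms by (auto simp: ds_pairs_iff)
  then show ?thesis
    using mult_rep_initial_segment_right[of \<kappa> \<mu> "src \<Lambda> \<mu>" \<nu>] assms cmp_src src_path by metis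
qed

text \<open>
  In the product formula \<open>\<mu>\<alpha> = \<nu>\<beta>\<close>, so every summand is self-adjoint, and hence so is the product.
\<close>
lemma mult_rep_commute:
  assumes "\<mu> \<in> Mor \<Lambda>" "\<nu> \<in> Mor \<Lambda>"
  shows "\<tau> \<mu> \<mu> * \<tau> \<nu> \<nu> = \<tau> \<nu> \<nu> * \<tau> \<mu> \<mu>"
proof -
  have ds: "(\<mu>, \<mu>) \<in> ds_pairs \<Lambda>" "(\<nu>, \<nu>) \<in> ds_pairs \<Lambda>" using assms by (auto simp: ds_pairs_iff)
  have "adj (\<tau> (cmp \<Lambda> \<mu> \<alpha>) (cmp \<Lambda> \<nu> \<beta>)) = \<tau> (cmp \<Lambda> \<mu> \<alpha>) (cmp \<Lambda> \<nu> \<beta>)"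
    if e: "(\<alpha>, \<beta>) \<in> extension_pairs G P \<Lambda> \<mu> \<nu>" for \<alpha> \<beta>
  proof -
    have "cmp \<Lambda> \<mu> \<alpha> = cmp \<Lambda> \<nu> \<beta>" using e by (simp add: extension_pairs_def)
    then show ?thesis using adj_rep[OF extension_pairs_ds(1)[OF ds e]] by simp
  qed
  then have "adj (\<tau> \<mu> \<mu> * \<tau> \<nu> \<nu>) = \<tau> \<mu> \<mu> * \<tau> \<nu> \<nu>"
    unfolding mult_rep[OF ds] adj_sum by (auto intro!: sum.cong)
  then show ?thesis by (simp add: adj_mult adj_rep ds)
qed


subsection \<open>Gap projections\<close>

text \<open>
  The part of the projection \<open>\<tau>\<^bsub>\<mu>,\<mu>\<^esub>\<close> that no path \<open>\<mu>\<alpha>\<close> with \<open>\<alpha> \<in> E\<close> covers.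
\<close>
definition gap :: "'m \<Rightarrow> 'm set \<Rightarrow> 'a" where
  "gap \<mu> E = commuting_prod (\<lambda>\<alpha>. \<tau> \<mu> \<mu> - \<tau> (cmp \<Lambda> \<mu> \<alpha>) (cmp \<Lambda> \<mu> \<alpha>)) E"

lemma gap_fix:
  assumes "finite E" "E \<noteq> {}" "\<And>\<alpha>. \<alpha> \<in> E \<Longrightarrow> (\<tau> \<mu> \<mu> - \<tau> (cmp \<Lambda> \<mu> \<alpha>) (cmp \<Lambda> \<mu> \<alpha>)) * y = y"
  shows "gap \<mu> E * y = y"
proof -
  let ?f = "\<lambda>\<alpha>. \<tau> \<mu> \<mu> - \<tau> (cmp \<Lambda> \<mu> \<alpha>) (cmp \<Lambda> \<mu> \<alpha>)"
  obtain xs where "set xs = E" "gap \<mu> E = mult_list (map ?f xs)"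
    unfolding gap_def using commuting_prod_cases[OF assms(1)] by blast
  then show ?thesis
    using assms(2,3) by (auto intro!: mult_list_fix)
qed

lemma gap_absorb_right:
  assumes \<mu>: "\<mu> \<in> Mor \<Lambda>" and E: "finite E" "E \<noteq> {}" "E \<subseteq> paths_to \<Lambda> (src \<Lambda> \<mu>)"
  shows "gap \<mu> E * \<tau> \<mu> \<mu> = gap \<mu> E"
proof -
  let ?f = "\<lambda>\<alpha>. \<tau> \<mu> \<mu> - \<tau> (cmp \<Lambda> \<mu> \<alpha>) (cmp \<Lambda> \<mu> \<alpha>)"
  obtain xs where xs: "set xs = E" "gap \<mu> E = mult_list (map ?f xs)"
    unfolding gap_def using commuting_prod_cases[OF E(1)] by blast
  have ds: "(\<mu>, \<mu>) \<in> ds_pairs \<Lambda>" using \<mu> by (simp add: ds_pairs_iff)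
  have "(\<tau> \<mu> \<mu> - \<tau> (cmp \<Lambda> \<mu> \<alpha>) (cmp \<Lambda> \<mu> \<alpha>)) * \<tau> \<mu> \<mu> = \<tau> \<mu> \<mu> - \<tau> (cmp \<Lambda> \<mu> \<alpha>) (cmp \<Lambda> \<mu> \<alpha>)"
    if \<alpha>: "\<alpha> \<in> E" for \<alpha>
  proof -
    have "(cmp \<Lambda> \<mu> \<alpha>, cmp \<Lambda> \<mu> \<alpha>) \<in> ds_pairs \<Lambda>"
      using cmp_path(1)[OF \<mu>] \<alpha> E(3) by (auto simp: ds_pairs_iff)
    then show ?thesis
      using mult_rep_initial_segment_right[of "cmp \<Lambda> \<mu> \<alpha>" \<mu> \<alpha> \<mu>] mult_rep_compose[OF ds ds] ds \<alpha> E(3)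
      by (auto simp: left_diff_distrib)
  qed
  then show ?thesis
    unfolding xs(2) using xs(1) E(2) by (intro mult_list_absorb_right) auto
qed

lemma gap_kill:
  assumes \<mu>: "\<mu> \<in> Mor \<Lambda>" and E: "finite E" "E \<subseteq> paths_to \<Lambda> (src \<Lambda> \<mu>)"
    and \<alpha>: "\<alpha> \<in> E" "(cmp \<Lambda> \<mu> \<alpha>, \<eta>) \<in> ds_pairs \<Lambda>"
  shows "gap \<mu> E * \<tau> (cmp \<Lambda> \<mu> \<alpha>) \<eta> = 0"
proof -
  let ?f = "\<lambda>\<alpha>. \<tau> \<mu> \<mu> - \<tau> (cmp \<Lambda> \<mu> \<alpha>) (cmp \<Lambda> \<mu> \<alpha>)"
  obtain xs where xs: "set xs = E" "gap \<mu> E = mult_list (map ?f xs)"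
    unfolding gap_def using commuting_prod_cases[OF E(1)] by blast
  have comm: "?f \<alpha> * ?f \<beta> = ?f \<beta> * ?f \<alpha>" if "\<alpha> \<in> E" "\<beta> \<in> E" for \<alpha> \<beta>
  proof -
    have "cmp \<Lambda> \<mu> \<alpha> \<in> Mor \<Lambda>" "cmp \<Lambda> \<mu> \<beta> \<in> Mor \<Lambda>" using that E(2) cmp_path(1)[OF \<mu>] by blast+
    then show ?thesis
      using mult_rep_commute \<mu> by (simp add: left_diff_distrib right_diff_distrib)
  qed
  have "(cmp \<Lambda> \<mu> \<alpha>, cmp \<Lambda> \<mu> \<alpha>) \<in> ds_pairs \<Lambda>" using \<alpha>(2) by (simp add: ds_pairs_iff)
  then have "\<tau> (cmp \<Lambda> \<mu> \<alpha>) (cmp \<Lambda> \<mu> \<alpha>) * \<tau> (cmp \<Lambda> \<mu> \<alpha>) \<eta> = \<tau> (cmp \<Lambda> \<mu> \<alpha>) \<eta>"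
    using \<alpha>(2) by (intro mult_rep_compose)
  moreover have "\<tau> \<mu> \<mu> * \<tau> (cmp \<Lambda> \<mu> \<alpha>) \<eta> = \<tau> (cmp \<Lambda> \<mu> \<alpha>) \<eta>"
    using \<mu> \<alpha> E(2) by (intro mult_rep_initial_segment_left) auto
  ultimately have "?f \<alpha> * \<tau> (cmp \<Lambda> \<mu> \<alpha>) \<eta> = 0" by (simp add: left_diff_distrib)
  then show ?thesis
    unfolding xs(2) using comm \<alpha>(1) xs(1) by (intro mult_list_kill[where x = "?f \<alpha>"]) auto
qed

text \<open>
  A path \<open>\<xi>\<close> without common extension with any member of \<open>E\<close> witnesses that \<open>E\<close> is not exhaustive,
  and then the projection of \<open>\<mu>\<xi>\<close> lies below the gap projection.
\<close>
lemma exhaustive_if_gap_eq_0: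
  assumes nz: "\<And>\<mu>. \<mu> \<in> Mor \<Lambda> \<Longrightarrow> \<tau> \<mu> \<mu> \<noteq> 0"
    and \<mu>: "\<mu> \<in> Mor \<Lambda>" and E: "finite E" "E \<noteq> {}" "E \<subseteq> paths_to \<Lambda> (src \<Lambda> \<mu>)" and "gap \<mu> E = 0"
  shows "exhaustive G P \<Lambda> (src \<Lambda> \<mu>) E"
proof (rule ccontr)
  assume "\<not> ?thesis"
  then obtain \<xi> where \<xi>: "\<xi> \<in> paths_to \<Lambda> (src \<Lambda> \<mu>)" "\<And>\<alpha>. \<alpha> \<in> E \<Longrightarrow> MCE G P \<Lambda> \<xi> \<alpha> = {}"
    using E(3) by (auto simp: exhaustive_def)
  let ?x = "cmp \<Lambda> \<mu> \<xi>"
  have x: "?x \<in> Mor \<Lambda>" using cmp_path(1)[OF \<mu> \<xi>(1)] .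
  then have ds: "(?x, ?x) \<in> ds_pairs \<Lambda>" by (simp add: ds_pairs_iff)
  have "(\<tau> \<mu> \<mu> - \<tau> (cmp \<Lambda> \<mu> \<alpha>) (cmp \<Lambda> \<mu> \<alpha>)) * \<tau> ?x ?x = \<tau> ?x ?x" if \<alpha>: "\<alpha> \<in> E" for \<alpha>
  proof -
    have a: "\<alpha> \<in> paths_to \<Lambda> (src \<Lambda> \<mu>)" using \<alpha> E(3) by blast
    let ?y = "cmp \<Lambda> \<mu> \<alpha>"
    have y: "?y \<in> Mor \<Lambda>" using cmp_path(1)[OF \<mu> a] .
    have "\<tau> ?x ?x * \<tau> ?y ?y = 0"
      using mult_rep[of ?x ?x ?y ?y] x y extension_pairs_empty[OF MCE_cmp_left_empty[OF \<mu> \<xi>(1) a \<xi>(2)[OF \<alpha>]]]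
      by (simp add: ds_pairs_iff)
    then have "\<tau> ?y ?y * \<tau> ?x ?x = 0" using mult_rep_commute[OF x y] by simp
    then show ?thesis
      using mult_rep_initial_segment_left[OF ds \<mu> \<xi>(1)] by (simp add: left_diff_distrib)
  qed
  then have "gap \<mu> E * \<tau> ?x ?x = \<tau> ?x ?x" by (rule gap_fix[OF E(1,2)])
  then show False using nz[OF x] assms(6) by simp
qed


subsection \<open>Spans of generators\<close>

text \<open>
  The complex linear span, written as a real span of all complex multiples so that it is a subspace
  in the sense of real vector spaces.
\<close>
definition rep_span :: "('m \<times> 'm) set \<Rightarrow> 'a set" where
  "rep_span S = span (\<Union>(\<mu>, \<nu>)\<in>S. range (\<lambda>c. c *\<^sub>C \<tau> \<mu> \<nu>))"

definition pairs_of_degree :: "'g set \<Rightarrow> ('m \<times> 'm) set" where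
  "pairs_of_degree D = {(\<mu>, \<nu>) \<in> ds_pairs \<Lambda>. deg \<Lambda> \<mu> \<in> D}"

abbreviation core :: "'g set \<Rightarrow> 'a set" where
  "core D \<equiv> rep_span (pairs_of_degree D)"

lemma subspace_rep_span: "subspace (rep_span S)"
  by (simp add: rep_span_def)

lemmas rep_span_add = subspace_add[OF subspace_rep_span]
  and rep_span_diff = subspace_diff[OF subspace_rep_span]
  and rep_span_zero = subspace_0[OF subspace_rep_span]
  and rep_span_sum = subspace_sum[OF subspace_rep_span]

lemma rep_span_base: "(\<mu>, \<nu>) \<in> S \<Longrightarrow> c *\<^sub>C \<tau> \<mu> \<nu> \<in> rep_span S"
  unfolding rep_span_def by (rule span_base) auto

lemma rep_span_base1: "(\<mu>, \<nu>) \<in> S \<Longrightarrow> \<tau> \<mu> \<nu> \<in> rep_span S"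
  using rep_span_base[of \<mu> \<nu> S 1] by simp

lemma rep_span_mono: "S \<subseteq> S' \<Longrightarrow> rep_span S \<subseteq> rep_span S'"
  unfolding rep_span_def by (rule span_mono) auto

lemma rep_span_subsetI:
  assumes "subspace W" "\<And>\<mu> \<nu> c. (\<mu>, \<nu>) \<in> S \<Longrightarrow> c *\<^sub>C \<tau> \<mu> \<nu> \<in> W"
  shows "rep_span S \<subseteq> W"
  unfolding rep_span_def using assms by (intro span_minimal) auto

lemma scaleC_rep_span:
  assumes "x \<in> rep_span S"
  shows "c *\<^sub>C x \<in> rep_span S"
proof -
  have "rep_span S \<subseteq> {x. c *\<^sub>C x \<in> rep_span S}"
    by (rule rep_span_subsetI)
      (auto simp: subspace_def scaleC_add_right scaleC_scaleR scaleC_scaleC rep_span_base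
        rep_span_zero rep_span_add subspace_scale[OF subspace_rep_span])
  with assms show ?thesis by blast
qed

lemma rep_span_Un:
  assumes "x \<in> rep_span (S \<union> S')"
  obtains y z where "y \<in> rep_span S" and "z \<in> rep_span S'" and "x = y + z"
  using assms that unfolding rep_span_def UN_Un span_Un by blast

lemma rep_span_insert:
  assumes "x \<in> rep_span (insert (\<mu>, \<nu>) S)"
  obtains c y where "y \<in> rep_span S" and "x = c *\<^sub>C \<tau> \<mu> \<nu> + y"
proof -
  have "insert (\<mu>, \<nu>) S = {(\<mu>, \<nu>)} \<union> S" by simp
  then obtain z y where zy: "z \<in> rep_span {(\<mu>, \<nu>)}" "y \<in> rep_span S" "x = z + y"
    using assms rep_span_Un by metis
  have "rep_span {(\<mu>, \<nu>)} \<subseteq> range (\<lambda>c. c *\<^sub>C \<tau> \<mu> \<nu>)"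
  proof (rule rep_span_subsetI)
    show "subspace (range (\<lambda>c. c *\<^sub>C \<tau> \<mu> \<nu>))"
      unfolding subspace_def
    proof (intro conjI allI ballI)
      show "0 \<in> range (\<lambda>c. c *\<^sub>C \<tau> \<mu> \<nu>)" by (rule range_eqI[of _ _ 0]) simp
      fix x y r assume "x \<in> range (\<lambda>c. c *\<^sub>C \<tau> \<mu> \<nu>)"
      then obtain a where a: "x = a *\<^sub>C \<tau> \<mu> \<nu>" by blast
      show "r *\<^sub>R x \<in> range (\<lambda>c. c *\<^sub>C \<tau> \<mu> \<nu>)" by (simp add: a scaleR_scaleC scaleC_scaleC)
      assume "y \<in> range (\<lambda>c. c *\<^sub>C \<tau> \<mu> \<nu>)"
      then obtain b where b: "y = b *\<^sub>C \<tau> \<mu> \<nu>" by blast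
      show "x + y \<in> range (\<lambda>c. c *\<^sub>C \<tau> \<mu> \<nu>)"
        by (rule range_eqI[of _ _ "a + b"]) (simp add: a b scaleC_add_left)
    qed
  qed auto
  with zy that show thesis by blast
qed

lemma rep_span_finite:
  assumes "x \<in> rep_span S"
  obtains F where "finite F" and "F \<subseteq> S" and "x \<in> rep_span F"
proof -
  let ?W = "{x. \<exists>F. finite F \<and> F \<subseteq> S \<and> x \<in> rep_span F}"
  have "rep_span S \<subseteq> ?W"
  proof (rule rep_span_subsetI)
    show "subspace ?W"
      unfolding subspace_def
    proof (intro conjI ballI allI)
      show "0 \<in> ?W" using rep_span_zero by blast
      fix x y assume "x \<in> ?W" "y \<in> ?W"
      then obtain F F' where "finite F" "F \<subseteq> S" "x \<in> rep_span F" "finite F'" "F' \<subseteq> S" "y \<in> rep_span F'"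
        by blast
      then have "finite (F \<union> F')" "F \<union> F' \<subseteq> S" "x + y \<in> rep_span (F \<union> F')"
        using rep_span_mono[of F "F \<union> F'"] rep_span_mono[of F' "F \<union> F'"]
        by (auto intro!: rep_span_add)
      then show "x + y \<in> ?W" by blast
    next
      fix c x assume "x \<in> ?W"
      then show "c *\<^sub>R x \<in> ?W" using subspace_scale[OF subspace_rep_span] by blast
    qed
    show "c *\<^sub>C \<tau> \<mu> \<nu> \<in> ?W" if "(\<mu>, \<nu>) \<in> S" for \<mu> \<nu> c
      using that rep_span_base[of \<mu> \<nu> "{(\<mu>, \<nu>)}"] by blast
  qed
  with assms that show thesis by blast
qed

lemma mult_rep_span:
  assumes units: "\<And>\<mu> \<nu> \<xi> \<eta>. (\<mu>, \<nu>) \<in> S \<Longrightarrow> (\<xi>, \<eta>) \<in> S' \<Longrightarrow> \<tau> \<mu> \<nu> * \<tau> \<xi> \<eta> \<in> rep_span U"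
    and x: "x \<in> rep_span S" and y: "y \<in> rep_span S'"
  shows "x * y \<in> rep_span U"
proof -
  have base: "(c *\<^sub>C \<tau> \<mu> \<nu>) * (d *\<^sub>C \<tau> \<xi> \<eta>) \<in> rep_span U"
    if "(\<mu>, \<nu>) \<in> S" "(\<xi>, \<eta>) \<in> S'" for \<mu> \<nu> \<xi> \<eta> c d
    using units[OF that] by (simp add: mult_scaleC_left mult_scaleC_right scaleC_rep_span)
  have "rep_span S' \<subseteq> {y. (c *\<^sub>C \<tau> \<mu> \<nu>) * y \<in> rep_span U}" if "(\<mu>, \<nu>) \<in> S" for c \<mu> \<nu>
    using base that
    by (intro rep_span_subsetI subspace_mult_left_vimage subspace_rep_span) auto
  with y have "(c *\<^sub>C \<tau> \<mu> \<nu>) * y \<in> rep_span U" if "(\<mu>, \<nu>) \<in> S" for c \<mu> \<nu>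
    using that by blast
  then have "rep_span S \<subseteq> {x. x * y \<in> rep_span U}"
    by (intro rep_span_subsetI subspace_mult_right_vimage subspace_rep_span) auto
  with x show ?thesis by blast
qed

text \<open>
  A product of generators of degrees \<open>p\<close> and \<open>q\<close> is a sum of generators of degree \<open>p \<or> q\<close>.
\<close>
lemma mult_core:
  assumes joins: "\<And>p q m. p \<in> D \<Longrightarrow> q \<in> E \<Longrightarrow> is_join G P p q m \<Longrightarrow> m \<in> F"
    and xy: "x \<in> core D" "y \<in> core E"
  shows "x * y \<in> core F"
proof (rule mult_rep_span[OF _ xy])
  fix \<mu> \<nu> \<xi> \<eta> assume "(\<mu>, \<nu>) \<in> pairs_of_degree D" "(\<xi>, \<eta>) \<in> pairs_of_degree E"
  then have ds: "(\<mu>, \<nu>) \<in> ds_pairs \<Lambda>" "(\<xi>, \<eta>) \<in> ds_pairs \<Lambda>" "deg \<Lambda> \<mu> \<in> D" "deg \<Lambda> \<xi> \<in> E"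
    by (auto simp: pairs_of_degree_def)
  have "\<tau> (cmp \<Lambda> \<mu> \<alpha>) (cmp \<Lambda> \<eta> \<beta>) \<in> core F" if e: "(\<alpha>, \<beta>) \<in> extension_pairs G P \<Lambda> \<nu> \<xi>" for \<alpha> \<beta>
    using extension_pairs_ds(1,2)[OF ds(1,2) e] joins[OF ds(3,4)]
    by (intro rep_span_base1) (auto simp: pairs_of_degree_def)
  then show "\<tau> \<mu> \<nu> * \<tau> \<xi> \<eta> \<in> core F"
    unfolding mult_rep[OF ds(1,2)] by (intro rep_span_sum) auto
qed

lemma adj_core:
  assumes "x \<in> core D"
  shows "adj x \<in> core D"
proof -
  have "core D \<subseteq> {x. adj x \<in> core D}"
  proof (rule rep_span_subsetI)
    show "subspace {x. adj x \<in> core D}"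
      using subspace_rep_span[of "pairs_of_degree D"] by (auto simp: subspace_def adj_add adj_scaleR)
    show "c *\<^sub>C \<tau> \<mu> \<nu> \<in> {x. adj x \<in> core D}" if "(\<mu>, \<nu>) \<in> pairs_of_degree D" for c \<mu> \<nu>
    proof -
      have "adj (\<tau> \<mu> \<nu>) = \<tau> \<nu> \<mu>" "(\<nu>, \<mu>) \<in> pairs_of_degree D"
        using that adj_rep by (auto simp: pairs_of_degree_def ds_pairs_iff)
      then show ?thesis by (simp add: adj_scaleC rep_span_base)
    qed
  qed
  with assms show ?thesis by blast
qed

end


context aligned_representation
begin

section \<open>The algebra spanned by finitely many degrees\<close>

lemma pairs_of_degree_remove:
  "p \<in> D \<Longrightarrow> pairs_of_degree D = pairs_of_degree {p} \<union> pairs_of_degree (D - {p})"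
  by (auto simp: pairs_of_degree_def)

lemma core_split:
  assumes "x \<in> core D" "p \<in> D"
  obtains y b where "y \<in> core {p}" and "b \<in> core (D - {p})" and "x = y + b"
  using assms(1) unfolding pairs_of_degree_remove[OF assms(2)] by (rule rep_span_Un) (rule that)

text \<open>
  Generators of one degree multiply like matrix units.  Those of a minimal degree \<open>p\<close> that occur in
  \<open>X\<close> involve finitely many paths, and so lie in the span of a finite set \<open>T\<close> closed under products up
  to scalars.  The span of the other degrees is an ideal, so the sandwiched elements to which
  \<open>subalgebra_hull_Un\<close> reduces the problem involve fewer degrees, and induction applies.
\<close>
lemma finite_dimensional_subalgebra_hull:
  assumes "finite D" "join_closed G P D" "finite X" "X \<subseteq> core D"
  shows "\<exists>Y. finite Y \<and> subalgebra hull X \<subseteq> span Y"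
  using assms
proof (induction D arbitrary: X rule: finite_psubset_induct)
  case (psubset D)
  have DP: "D \<subseteq> P" using psubset.prems(1) unfolding join_closed_def by blast
  show ?case
  proof (cases "D = {}")
    case True
    then have "core D = {0}" by (simp add: rep_span_def pairs_of_degree_def)
    moreover have "subalgebra {0::'a}" by (auto simp: subalgebra_def subspace_def)
    ultimately have "subalgebra hull X \<subseteq> {0}"
      using psubset.prems(3) by (intro hull_minimal) auto
    then show ?thesis by (intro exI[of _ "{}"]) auto
  next
    case False
    then obtain p where p: "p \<in> D" "\<And>q. q \<in> D \<Longrightarrow> qlo_le G P q p \<Longrightarrow> q = p"
      using ex_minimal psubset.hyps DP by metis
    define D' where "D' = D - {p}"
    note absorbing = join_absorbing_of_minimal[OF psubset.prems(1) p(2), folded D'_def]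
    have D': "join_closed G P D'" "D' \<subset> D"
      using join_closed_remove_minimal[OF psubset.prems(1) p(2)] p(1) by (auto simp: D'_def)
    have "\<exists>S b. finite S \<and> S \<subseteq> pairs_of_degree {p} \<and> b \<in> core D' \<and> x - b \<in> rep_span S"
      if x: "x \<in> X" for x
    proof -
      obtain y b where yb: "y \<in> core {p}" "b \<in> core D'" "x = y + b"
        using core_split[OF subsetD[OF psubset.prems(3) x] p(1)] unfolding D'_def .
      moreover obtain S where "finite S" "S \<subseteq> pairs_of_degree {p}" "y \<in> rep_span S"
        using rep_span_finite[OF yb(1)] .
      ultimately show ?thesis by (intro exI[of _ S] exI[of _ b]) auto
    qed
    then obtain S b where Sb: "\<And>x. x \<in> X \<Longrightarrow> finite (S x)" "\<And>x. x \<in> X \<Longrightarrow> S x \<subseteq> pairs_of_degree {p}"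
      "\<And>x. x \<in> X \<Longrightarrow> b x \<in> core D'" "\<And>x. x \<in> X \<Longrightarrow> x - b x \<in> rep_span (S x)"
      by metis
    define F where "F = fst ` (\<Union>x\<in>X. S x) \<union> snd ` (\<Union>x\<in>X. S x)"
    define Q where "Q = {(\<mu>, \<nu>) \<in> F \<times> F. (\<mu>, \<nu>) \<in> ds_pairs \<Lambda>}"
    have degF: "deg \<Lambda> \<mu> = p" if "\<mu> \<in> F" for \<mu>
      using that Sb(2) unfolding F_def pairs_of_degree_def ds_pairs_iff by force
    have SQ: "S x \<subseteq> Q" if "x \<in> X" for x
      using that Sb(2) unfolding Q_def F_def pairs_of_degree_def by force
    have "finite F" using Sb(1) psubset.prems(2) by (auto simp: F_def)
    then have "finite (F \<times> F)" by simp
    then have finQ: "finite Q" by (rule finite_subset[rotated]) (auto simp: Q_def)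
    have Qp: "Q \<subseteq> pairs_of_degree {p}" using degF by (auto simp: Q_def pairs_of_degree_def)
    \<comment> \<open>The multiples by \<open>\<i>\<close> turn the complex span of the generators into a real span.\<close>
    define T where "T = (\<lambda>(\<mu>, \<nu>). \<tau> \<mu> \<nu>) ` Q \<union> (\<lambda>(\<mu>, \<nu>). \<i> *\<^sub>C \<tau> \<mu> \<nu>) ` Q"
    have TQ: "span T = rep_span Q"
    proof
      show "span T \<subseteq> rep_span Q"
        by (rule span_minimal) (auto simp: T_def rep_span_base rep_span_base1 subspace_rep_span)
      show "rep_span Q \<subseteq> span T"
      proof (rule rep_span_subsetI)
        fix \<mu> \<nu> c assume "(\<mu>, \<nu>) \<in> Q"
        then have "Re c *\<^sub>R \<tau> \<mu> \<nu> + Im c *\<^sub>R (\<i> *\<^sub>C \<tau> \<mu> \<nu>) \<in> span T"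
          by (intro span_add span_scale span_base) (auto simp: T_def)
        moreover have "c *\<^sub>C \<tau> \<mu> \<nu> = Re c *\<^sub>R \<tau> \<mu> \<nu> + Im c *\<^sub>R (\<i> *\<^sub>C \<tau> \<mu> \<nu>)"
          using scaleC_add_left[of "complex_of_real (Re c)" "complex_of_real (Im c) * \<i>" "\<tau> \<mu> \<nu>"]
          by (simp add: scaleR_scaleC scaleC_scaleC mult.commute[of _ \<i>] flip: complex_eq)
        ultimately show "c *\<^sub>C \<tau> \<mu> \<nu> \<in> span T" by simp
      qed (rule subspace_span)
    qed
    have units: "\<tau> \<mu> \<nu> * \<tau> \<xi> \<eta> \<in> rep_span Q" if Q: "(\<mu>, \<nu>) \<in> Q" "(\<xi>, \<eta>) \<in> Q" for \<mu> \<nu> \<xi> \<eta>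
    proof -
      have ds: "(\<mu>, \<nu>) \<in> ds_pairs \<Lambda>" "(\<xi>, \<eta>) \<in> ds_pairs \<Lambda>" "deg \<Lambda> \<mu> = deg \<Lambda> \<xi>" "\<mu> \<in> F" "\<eta> \<in> F"
        using Q degF by (auto simp: Q_def)
      show ?thesis
      proof (cases "\<nu> = \<xi>")
        case True
        then have "(\<mu>, \<eta>) \<in> Q" using ds by (auto simp: Q_def ds_pairs_iff)
        then show ?thesis using True ds mult_rep_compose[of \<mu> \<nu> \<eta>] by (simp add: rep_span_base1)
      next
        case False
        then show ?thesis using mult_rep_same_degree[OF ds(1-3)] by (simp add: rep_span_zero)
      qed
    qed
    have M: "m * m' \<in> span T" if "m \<in> span T" "m' \<in> span T" for m m'
      using that unfolding TQ by (rule mult_rep_span[rotated]) (rule units)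
    define Z where "Z = b ` X \<union> {t * x | t x. t \<in> T \<and> x \<in> b ` X} \<union> {x * t | x t. x \<in> b ` X \<and> t \<in> T} \<union>
      {t * x * t' | t x t'. t \<in> T \<and> x \<in> b ` X \<and> t' \<in> T}"
    have "{t * x * t' | t x t'. t \<in> T \<and> x \<in> b ` X \<and> t' \<in> T} =
        (\<lambda>(t, x, t'). t * x * t') ` (T \<times> b ` X \<times> T)"
      by force
    moreover have finT: "finite T" using finQ by (simp add: T_def)
    ultimately have "finite Z"
      using psubset.prems(2) by (auto simp: Z_def intro!: finite_image_set2)
    moreover have "Z \<subseteq> core D'"
    proof -
      have TD: "t \<in> core {p}" if "t \<in> T" for t
        using span_base[OF that] rep_span_mono[OF Qp] TQ by blast
      have b: "x \<in> core D'" if "x \<in> b ` X" for x using that Sb(3) by blast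
      have l: "t * x \<in> core D'" if "t \<in> core {p}" "x \<in> core D'" for t x
        using that by (rule mult_core[rotated]) (use absorbing p(1) in blast)
      have r: "x * t \<in> core D'" if "t \<in> core {p}" "x \<in> core D'" for t x
        using that(2,1) by (rule mult_core[rotated]) (use absorbing p(1) in blast)
      show ?thesis unfolding Z_def using b l r TD by blast
    qed
    ultimately obtain Y where Y: "finite Y" "subalgebra hull Z \<subseteq> span Y"
      using psubset.IH[OF D'(2,1)] by blast
    have "X \<subseteq> subalgebra hull (T \<union> b ` X)"
    proof
      fix x assume x: "x \<in> X"
      have sub: "subspace (subalgebra hull (T \<union> b ` X))"
        using subalgebra_hull unfolding subalgebra_def by blast
      have "T \<subseteq> subalgebra hull (T \<union> b ` X)" using hull_subset[of "T \<union> b ` X" subalgebra] by blast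
      then have "span T \<subseteq> subalgebra hull (T \<union> b ` X)" by (intro span_minimal sub)
      moreover have "x - b x \<in> span T" using Sb(4)[OF x] rep_span_mono[OF SQ[OF x]] TQ by blast
      moreover have "b x \<in> subalgebra hull (T \<union> b ` X)" using x by (intro hull_inc) blast
      ultimately have "(x - b x) + b x \<in> subalgebra hull (T \<union> b ` X)"
        by (intro subspace_add[OF sub]) auto
      then show "x \<in> subalgebra hull (T \<union> b ` X)" by simp
    qed
    then have "subalgebra hull X \<subseteq> subalgebra hull (T \<union> b ` X)"
      by (rule hull_minimal) (rule subalgebra_hull)
    also have "\<dots> \<subseteq> span (T \<union> Y)"
    proof
      fix u assume "u \<in> subalgebra hull (T \<union> b ` X)"
      then obtain m h where "m \<in> span T" "h \<in> subalgebra hull Z" "u = m + h"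
        using subalgebra_hull_Un[OF M] unfolding Z_def by blast
      then show "u \<in> span (T \<union> Y)"
        using Y(2) span_mono[of T "T \<union> Y"] span_mono[of Y "T \<union> Y"] by (auto intro!: span_add)
    qed
    finally show ?thesis using finT Y(1) by blast
  qed
qed

lemma finite_dimensional_star_subalgebra:
  assumes D: "finite D" "join_closed G P D" and a: "a \<in> core D"
  obtains A Y where "star_subalgebra A" and "a \<in> A" and "A \<subseteq> core D" and "A \<subseteq> span Y" and "finite Y"
proof -
  define X where "X = {a, adj a}"
  have X: "finite X" "X \<subseteq> core D" using a adj_core by (auto simp: X_def)
  define A where "A = subalgebra hull X"
  have "x * y \<in> core D" if "x \<in> core D" "y \<in> core D" for x y
    using that by (rule mult_core[rotated]) (use D(2)[unfolded join_closed_def] in blast)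
  then have "subalgebra (core D)"
    by (simp add: subalgebra_def subspace_rep_span)
  then have "A \<subseteq> core D"
    unfolding A_def using X by (intro hull_minimal)
  have alg: "subspace A" "\<And>x y. x \<in> A \<Longrightarrow> y \<in> A \<Longrightarrow> x * y \<in> A"
    using subalgebra_hull[of X] by (auto simp: A_def subalgebra_def)
  have "adj x \<in> A" if "x \<in> A" for x
    using that[unfolded A_def]
  proof (rule hull_induct)
    show "adj x \<in> A" if "x \<in> X" for x
      unfolding A_def using that by (intro hull_inc) (auto simp: X_def adj_adj)
    show "subalgebra {x. adj x \<in> A}"
      using alg unfolding subalgebra_def subspace_def by (auto simp: adj_add adj_scaleR adj_mult)
  qed
  then have "star_subalgebra A" using alg by (simp add: star_subalgebra_def)
  moreover have "a \<in> A" unfolding A_def by (rule hull_inc) (simp add: X_def)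
  moreover obtain Y where "finite Y" "A \<subseteq> span Y"
    using finite_dimensional_subalgebra_hull[OF D X] unfolding A_def by blast
  ultimately show thesis using that \<open>A \<subseteq> core D\<close> by blast
qed

text \<open>
  Expanding the product that defines the gap projection gives \<open>\<tau>\<^bsub>\<mu>,\<mu>\<^esub>\<close> and terms in the ideal spanned
  by the degrees other than \<open>p\<close>.
\<close>
lemma gap_mult_rep:
  assumes D: "join_closed G P D" "\<And>q. q \<in> D \<Longrightarrow> qlo_le G P q p \<Longrightarrow> q = p" "p \<in> D"
    and \<mu>: "(\<mu>, \<nu>) \<in> ds_pairs \<Lambda>" "deg \<Lambda> \<mu> = p"
    and E: "finite E" "E \<noteq> {}" "E \<subseteq> paths_to \<Lambda> (src \<Lambda> \<mu>)"
    and degE: "\<And>\<alpha>. \<alpha> \<in> E \<Longrightarrow> deg \<Lambda> (cmp \<Lambda> \<mu> \<alpha>) \<in> D - {p}"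
  shows "gap \<mu> E * \<tau> \<mu> \<nu> - \<tau> \<mu> \<nu> \<in> core (D - {p})"
proof -
  let ?f = "\<lambda>\<alpha>. \<tau> \<mu> \<mu> - \<tau> (cmp \<Lambda> \<mu> \<alpha>) (cmp \<Lambda> \<mu> \<alpha>)"
  obtain xs where xs: "set xs = E" "gap \<mu> E = mult_list (map ?f xs)"
    unfolding gap_def using commuting_prod_cases[OF E(1)] by blast
  note absorbing = join_absorbing_of_minimal[OF D(1,2)]
  have m: "\<mu> \<in> Mor \<Lambda>" "(\<mu>, \<mu>) \<in> ds_pairs \<Lambda>" using \<mu> by (auto simp: ds_pairs_iff)
  have ideal: "x * y \<in> core (D - {p})" if "x \<in> core D" "y \<in> core (D - {p})" for x y
    using that by (rule mult_core[rotated]) (use absorbing in blast)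
  have ideal': "x * y \<in> core (D - {p})" if "x \<in> core (D - {p})" "y \<in> core D" for x y
    using that by (rule mult_core[rotated]) (use absorbing in blast)
  have D_sub: "core (D - {p}) \<subseteq> core D" by (rule rep_span_mono) (auto simp: pairs_of_degree_def)
  have \<tau>D: "\<tau> \<mu> \<nu> \<in> core D" "\<tau> \<mu> \<mu> \<in> core D"
    using \<mu> m D(3) by (auto intro!: rep_span_base1 simp: pairs_of_degree_def)
  have q: "\<tau> (cmp \<Lambda> \<mu> \<alpha>) (cmp \<Lambda> \<mu> \<alpha>) \<in> core (D - {p})" if "\<alpha> \<in> E" for \<alpha>
    using that degE cmp_path(1)[OF m(1)] E(3)
    by (intro rep_span_base1) (auto simp: pairs_of_degree_def ds_pairs_iff)
  have f: "?f \<alpha> \<in> core D" if "\<alpha> \<in> E" for \<alpha>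
    using q[OF that] \<tau>D D_sub by (intro rep_span_diff) auto
  have step: "?f \<alpha> * \<tau> \<mu> \<nu> - \<tau> \<mu> \<nu> \<in> core (D - {p})" if "\<alpha> \<in> E" for \<alpha>
  proof -
    have "?f \<alpha> * \<tau> \<mu> \<nu> - \<tau> \<mu> \<nu> = 0 - \<tau> (cmp \<Lambda> \<mu> \<alpha>) (cmp \<Lambda> \<mu> \<alpha>) * \<tau> \<mu> \<nu>"
      using mult_rep_compose[OF m(2) \<mu>(1)] by (simp add: left_diff_distrib)
    then show ?thesis
      using ideal'[OF q[OF that] \<tau>D(1)] rep_span_zero rep_span_diff by metis
  qed
  have "xs \<noteq> []" "set xs \<subseteq> E" using xs(1) E(2) by auto
  then have "mult_list (map ?f xs) * \<tau> \<mu> \<nu> - \<tau> \<mu> \<nu> \<in> core (D - {p})"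
  proof (induction xs rule: list_nonempty_induct)
    case (single \<alpha>)
    then show ?case using step by simp
  next
    case (cons \<alpha> xs)
    let ?y = "mult_list (map ?f xs) * \<tau> \<mu> \<nu> - \<tau> \<mu> \<nu>"
    have "mult_list (map ?f (\<alpha> # xs)) * \<tau> \<mu> \<nu> - \<tau> \<mu> \<nu> = ?f \<alpha> * ?y + (?f \<alpha> * \<tau> \<mu> \<nu> - \<tau> \<mu> \<nu>)"
      using cons.hyps by (simp add: mult_list_Cons mult.assoc right_diff_distrib)
    moreover have "\<alpha> \<in> E" "?y \<in> core (D - {p})"
      using cons by auto
    then have "?f \<alpha> * ?y + (?f \<alpha> * \<tau> \<mu> \<nu> - \<tau> \<mu> \<nu>) \<in> core (D - {p})"
      by (intro rep_span_add ideal f step)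
    ultimately show ?case by (simp only:)
  qed
  then show ?thesis by (simp add: xs(2))
qed

text \<open>
  Finitely many initial segments \<open>\<mu>\<alpha>\<close> account for \<open>\<tau>\<^bsub>\<mu>,\<mu>\<^esub> b\<close>.  The gap projection for the set of these
  \<open>\<alpha>\<close> annihilates it.
\<close>
lemma vertex_mult_core:
  assumes \<mu>: "\<mu> \<in> Mor \<Lambda>" and b: "b \<in> core D'"
    and joins: "\<And>q m. q \<in> D' \<Longrightarrow> is_join G P (deg \<Lambda> \<mu>) q m \<Longrightarrow> m \<in> D'"
  obtains E where "finite E" and "E \<subseteq> paths_to \<Lambda> (src \<Lambda> \<mu>)"
    and "\<And>\<alpha>. \<alpha> \<in> E \<Longrightarrow> deg \<Lambda> (cmp \<Lambda> \<mu> \<alpha>) \<in> D'"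
    and "\<tau> \<mu> \<mu> * b \<in> rep_span {(cmp \<Lambda> \<mu> \<alpha>, \<eta>) | \<alpha> \<eta>. \<alpha> \<in> E \<and> (cmp \<Lambda> \<mu> \<alpha>, \<eta>) \<in> ds_pairs \<Lambda>}"
proof -
  define U where "U E = {(cmp \<Lambda> \<mu> \<alpha>, \<eta>) | \<alpha> \<eta>. \<alpha> \<in> E \<and> (cmp \<Lambda> \<mu> \<alpha>, \<eta>) \<in> ds_pairs \<Lambda>}" for E
  define good where "good E \<longleftrightarrow> finite E \<and> E \<subseteq> paths_to \<Lambda> (src \<Lambda> \<mu>) \<and> (\<forall>\<alpha>\<in>E. deg \<Lambda> (cmp \<Lambda> \<mu> \<alpha>) \<in> D')" for E
  have U_mono: "rep_span (U E) \<subseteq> rep_span (U E')" if "E \<subseteq> E'" for E E'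
    using that by (intro rep_span_mono) (auto simp: U_def)
  have ds: "(\<mu>, \<mu>) \<in> ds_pairs \<Lambda>" using \<mu> by (simp add: ds_pairs_iff)
  let ?W = "{b. \<exists>E. good E \<and> \<tau> \<mu> \<mu> * b \<in> rep_span (U E)}"
  have "core D' \<subseteq> ?W"
  proof (rule rep_span_subsetI)
    show "subspace ?W"
      unfolding subspace_def
    proof (intro conjI ballI allI)
      have "good {}" by (simp add: good_def)
      then show "0 \<in> ?W" using rep_span_zero by auto
      fix x y assume "x \<in> ?W" "y \<in> ?W"
      then obtain E E' where E: "good E" "\<tau> \<mu> \<mu> * x \<in> rep_span (U E)" "good E'" "\<tau> \<mu> \<mu> * y \<in> rep_span (U E')"
        by blast
      then have "\<tau> \<mu> \<mu> * (x + y) \<in> rep_span (U (E \<union> E'))"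
        using U_mono[of E "E \<union> E'"] U_mono[of E' "E \<union> E'"]
        unfolding distrib_left by (intro rep_span_add) auto
      moreover have "good (E \<union> E')" using E by (auto simp: good_def)
      ultimately show "x + y \<in> ?W" by blast
    next
      fix c x assume "x \<in> ?W"
      then show "c *\<^sub>R x \<in> ?W" using subspace_scale[OF subspace_rep_span] by auto
    qed
    fix \<xi> \<eta> c assume "(\<xi>, \<eta>) \<in> pairs_of_degree D'"
    then have \<xi>: "(\<xi>, \<eta>) \<in> ds_pairs \<Lambda>" "deg \<Lambda> \<xi> \<in> D'" by (auto simp: pairs_of_degree_def)
    define E where "E = fst ` extension_pairs G P \<Lambda> \<mu> \<xi>"
    have "finite E"
      unfolding E_def using \<mu> \<xi> by (intro finite_imageI finite_extension_pairs aligned) (auto simp: ds_pairs_iff)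
    then have "good E"
      using extension_pairs_ds(2,3)[OF ds \<xi>(1)] joins[OF \<xi>(2)] unfolding good_def E_def by force
    moreover have "(cmp \<Lambda> \<mu> \<alpha>, cmp \<Lambda> \<eta> \<beta>) \<in> U E" if "(\<alpha>, \<beta>) \<in> extension_pairs G P \<Lambda> \<mu> \<xi>" for \<alpha> \<beta>
      using extension_pairs_ds(1)[OF ds \<xi>(1) that] that unfolding U_def E_def by force
    then have "\<tau> \<mu> \<mu> * (c *\<^sub>C \<tau> \<xi> \<eta>) \<in> rep_span (U E)"
      unfolding mult_scaleC_right mult_rep[OF ds \<xi>(1)]
      by (intro scaleC_rep_span rep_span_sum) (auto intro!: rep_span_base1)
    ultimately show "c *\<^sub>C \<tau> \<xi> \<eta> \<in> ?W" by blast
  qed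
  then obtain E where "good E" "\<tau> \<mu> \<mu> * b \<in> rep_span (U E)" using b by blast
  with that[of E] show thesis unfolding good_def U_def by blast
qed

end


section \<open>The kernel of a homomorphism between representations\<close>

lemma closed_ideal_closed_ideal_generated: "closed_ideal (closed_ideal_generated X)"
  unfolding closed_ideal_generated_def closed_ideal_def by (auto intro!: closed_Inter)

lemma closed_ideal_generated_superset: "X \<subseteq> closed_ideal_generated X"
  by (auto simp: closed_ideal_generated_def)

lemma closed_ideal_generated_minimal: "closed_ideal J \<Longrightarrow> X \<subseteq> J \<Longrightarrow> closed_ideal_generated X \<subseteq> J"
  by (auto simp: closed_ideal_generated_def)

locale representation_comparison =
  \<omega>: aligned_representation G P \<Lambda> \<omega> + \<tau>: aligned_representation G P \<Lambda> \<tau> + star_hom \<rho>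
  for G (structure) and P :: "'g set" and \<Lambda> :: "('m, 'g) graph_data"
    and \<omega> :: "'m \<Rightarrow> 'm \<Rightarrow> 'u::cstar_algebra" and \<tau> :: "'m \<Rightarrow> 'm \<Rightarrow> 'b::cstar_algebra"
    and \<rho> :: "'u \<Rightarrow> 'b" +
  assumes hom_rep: "(\<mu>, \<nu>) \<in> ds_pairs \<Lambda> \<Longrightarrow> \<rho> (\<omega> \<mu> \<nu>) = \<tau> \<mu> \<nu>"
    and nonzero: "\<mu> \<in> Mor \<Lambda> \<Longrightarrow> \<tau> \<mu> \<mu> \<noteq> 0"
begin

lemma hom_gap:
  assumes \<mu>: "\<mu> \<in> Mor \<Lambda>" and E: "finite E" "E \<subseteq> paths_to \<Lambda> (src \<Lambda> \<mu>)"
  shows "\<rho> (\<omega>.gap \<mu> E) = \<tau>.gap \<mu> E"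
  unfolding \<omega>.gap_def \<tau>.gap_def hom_commuting_prod
proof (rule commuting_prod_cong[OF E(1)])
  fix \<alpha> assume "\<alpha> \<in> E"
  then have "cmp \<Lambda> \<mu> \<alpha> \<in> Mor \<Lambda>" using \<omega>.cmp_path(1)[OF \<mu>] E(2) by blast
  then show "\<rho> (\<omega> \<mu> \<mu> - \<omega> (cmp \<Lambda> \<mu> \<alpha>) (cmp \<Lambda> \<mu> \<alpha>)) = \<tau> \<mu> \<mu> - \<tau> (cmp \<Lambda> \<mu> \<alpha>) (cmp \<Lambda> \<mu> \<alpha>)"
    using \<mu> by (simp add: hom_diff hom_rep \<omega>.ds_pairs_iff)
qed

definition vanishing_gaps :: "'u set" where
  "vanishing_gaps = (\<Union>\<mu>\<in>Mor \<Lambda>. {\<omega>.gap \<mu> E | E.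
     finite E \<and> exhaustive G P \<Lambda> (src \<Lambda> \<mu>) E \<and> \<tau>.gap \<mu> E = 0})"

abbreviation gap_ideal :: "'u set" where
  "gap_ideal \<equiv> closed_ideal_generated vanishing_gaps"

lemma gap_ideal:
  "closed gap_ideal" "0 \<in> gap_ideal" "x \<in> gap_ideal \<Longrightarrow> y \<in> gap_ideal \<Longrightarrow> x + y \<in> gap_ideal"
  "x \<in> gap_ideal \<Longrightarrow> c *\<^sub>C x \<in> gap_ideal" "x \<in> gap_ideal \<Longrightarrow> x * a \<in> gap_ideal"
  using closed_ideal_closed_ideal_generated[of vanishing_gaps] unfolding closed_ideal_def by blast+

lemma hom_gap_ideal:
  assumes "x \<in> gap_ideal"
  shows "\<rho> x = 0"
proof -
  have "vanishing_gaps \<subseteq> {x. \<rho> x = 0}"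
    using hom_gap by (auto simp: vanishing_gaps_def exhaustive_def)
  with assms show ?thesis using closed_ideal_generated_minimal[OF closed_ideal_kernel] by blast
qed

text \<open>
  This is where the generators of the ideal come from.  Compressing the kernel element by \<open>\<omega>\<^bsub>\<mu>,\<mu>\<^esub>\<close> on
  the left and \<open>\<omega>\<^bsub>\<nu>,\<nu>\<^esub>\<close> on the right leaves \<open>c \<omega>\<^bsub>\<mu>,\<nu>\<^esub>\<close> and terms \<open>\<omega>\<^bsub>\<mu>\<alpha>,\<eta>\<^esub>\<close> with finitely many \<open>\<alpha>\<close>.  The gap
  projection \<open>q\<close> for these \<open>\<alpha>\<close> kills the latter, so \<open>c q \<omega>\<^bsub>\<mu>,\<nu>\<^esub>\<close> is in the kernel; as \<open>c \<noteq> 0\<close>, so is \<open>q\<close>.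
  By \<open>exhaustive_if_gap_eq_0\<close> it is one of the generators, and \<open>i = q \<omega>\<^bsub>\<mu>,\<nu>\<^esub>\<close>.
\<close>
lemma minimal_unit_congruent_core:
  assumes D: "join_closed G P D" "\<And>q. q \<in> D \<Longrightarrow> qlo_le G P q p \<Longrightarrow> q = p" "p \<in> D"
    and \<mu>\<nu>: "(\<mu>, \<nu>) \<in> \<omega>.pairs_of_degree {p}"
    and S: "S \<subseteq> \<omega>.pairs_of_degree {p}" "(\<mu>, \<nu>) \<notin> S"
    and x: "x \<in> \<omega>.rep_span S" and b: "b \<in> \<omega>.core (D - {p})" and c: "c \<noteq> 0"
    and ker: "\<rho> (c *\<^sub>C \<omega> \<mu> \<nu> + x + b) = 0"
  obtains i where "i \<in> gap_ideal" and "\<omega> \<mu> \<nu> - i \<in> \<omega>.core (D - {p})"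
proof -
  have ds: "(\<mu>, \<nu>) \<in> ds_pairs \<Lambda>" "(\<mu>, \<mu>) \<in> ds_pairs \<Lambda>" "(\<nu>, \<nu>) \<in> ds_pairs \<Lambda>" "(\<nu>, \<mu>) \<in> ds_pairs \<Lambda>"
    and deg: "deg \<Lambda> \<mu> = p" "deg \<Lambda> \<nu> = p" and \<mu>: "\<mu> \<in> Mor \<Lambda>"
    using \<mu>\<nu> by (auto simp: \<omega>.pairs_of_degree_def \<omega>.ds_pairs_iff)
  note absorbing = \<omega>.join_absorbing_of_minimal[OF D(1,2)]
  define b' where "b' = b * \<omega> \<nu> \<nu>"
  have \<nu>D: "\<omega> \<nu> \<nu> \<in> \<omega>.core D"
    using ds deg D(3) by (auto intro!: \<omega>.rep_span_base1 simp: \<omega>.pairs_of_degree_def)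
  have b': "b' \<in> \<omega>.core (D - {p})"
    unfolding b'_def by (rule \<omega>.mult_core[OF _ b \<nu>D]) (use absorbing in blast)
  obtain E where E: "finite E" "E \<subseteq> paths_to \<Lambda> (src \<Lambda> \<mu>)" "\<And>\<alpha>. \<alpha> \<in> E \<Longrightarrow> deg \<Lambda> (cmp \<Lambda> \<mu> \<alpha>) \<in> D - {p}"
    "\<omega> \<mu> \<mu> * b' \<in> \<omega>.rep_span {(cmp \<Lambda> \<mu> \<alpha>, \<eta>) | \<alpha> \<eta>. \<alpha> \<in> E \<and> (cmp \<Lambda> \<mu> \<alpha>, \<eta>) \<in> ds_pairs \<Lambda>}"
    by (rule \<omega>.vertex_mult_core[OF \<mu> b']) (use absorbing D(3) deg in blast)+
  have "\<omega>.rep_span S \<subseteq> {x. \<omega> \<mu> \<mu> * x * \<omega> \<nu> \<nu> = 0}"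
  proof (rule \<omega>.rep_span_subsetI)
    show "subspace {x. \<omega> \<mu> \<mu> * x * \<omega> \<nu> \<nu> = 0}"
      by (auto simp: subspace_def distrib_left distrib_right)
    fix \<xi> \<eta> d assume \<xi>: "(\<xi>, \<eta>) \<in> S"
    then have \<xi>': "(\<xi>, \<eta>) \<in> ds_pairs \<Lambda>" "deg \<Lambda> \<xi> = p" "deg \<Lambda> \<eta> = p" "\<mu> \<noteq> \<xi> \<or> \<eta> \<noteq> \<nu>"
      using S by (auto simp: \<omega>.pairs_of_degree_def \<omega>.ds_pairs_iff)
    have "\<omega> \<mu> \<mu> * \<omega> \<xi> \<eta> * \<omega> \<nu> \<nu> = 0"
    proof (cases "\<mu> = \<xi>")
      case True
      then show ?thesis
        using \<omega>.mult_rep_same_degree[OF \<xi>'(1) ds(3)] \<xi>' deg by (simp add: mult.assoc)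
    next
      case False
      then show ?thesis
        using \<omega>.mult_rep_same_degree[OF ds(2) \<xi>'(1)] \<xi>' deg by simp
    qed
    then show "d *\<^sub>C \<omega> \<xi> \<eta> \<in> {x. \<omega> \<mu> \<mu> * x * \<omega> \<nu> \<nu> = 0}"
      by (simp add: mult_scaleC_left mult_scaleC_right)
  qed
  with x have "\<omega> \<mu> \<mu> * x * \<omega> \<nu> \<nu> = 0" by blast
  then have corner: "\<omega> \<mu> \<mu> * (c *\<^sub>C \<omega> \<mu> \<nu> + x + b) * \<omega> \<nu> \<nu> = c *\<^sub>C \<omega> \<mu> \<nu> + \<omega> \<mu> \<mu> * b'"
    using \<omega>.mult_rep_compose[OF ds(2,1)] \<omega>.mult_rep_compose[OF ds(1,3)]
    by (simp add: b'_def distrib_left distrib_right mult_scaleC_left mult_scaleC_right mult.assoc)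
  have corner0: "\<rho> (c *\<^sub>C \<omega> \<mu> \<nu> + \<omega> \<mu> \<mu> * b') = 0"
    unfolding corner[symmetric] by (simp add: hom_mult ker)
  \<comment> \<open>Right multiplication by \<open>c \<tau>\<^bsub>\<mu>,\<nu>\<^esub>\<close> is injective on elements supported on \<open>\<tau>\<^bsub>\<mu>,\<mu>\<^esub>\<close>.\<close>
  have zero: "z = 0" if "c *\<^sub>C (z * \<tau> \<mu> \<nu>) = 0" "z * \<tau> \<mu> \<mu> = z" for z
  proof -
    have "z * \<tau> \<mu> \<nu> = inverse c *\<^sub>C (c *\<^sub>C (z * \<tau> \<mu> \<nu>))" using c by (simp add: scaleC_scaleC)
    then have "z * (\<tau> \<mu> \<nu> * \<tau> \<nu> \<mu>) = 0" using that(1) by (simp flip: mult.assoc)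
    then show "z = 0" using \<tau>.mult_rep_compose[OF ds(1,4)] that(2) by simp
  qed
  \<comment> \<open>The empty family has no gap projection, but then \<open>\<omega>\<^bsub>\<mu>,\<nu>\<^esub>\<close> itself would be in the kernel.\<close>
  have "E \<noteq> {}"
  proof
    assume "E = {}"
    then have "\<omega> \<mu> \<mu> * b' = 0" using E(4) by (simp add: \<omega>.rep_span_def)
    then have "c *\<^sub>C \<tau> \<mu> \<nu> = 0" using corner0 by (simp add: hom_scaleC hom_rep ds)
    then have "\<tau> \<mu> \<mu> = 0"
      using zero[of "\<tau> \<mu> \<mu>"] \<tau>.mult_rep_compose[OF ds(2,1)] \<tau>.mult_rep_compose[OF ds(2,2)] by simp
    with nonzero[OF \<mu>] show False by simp
  qed
  have "\<omega>.rep_span {(cmp \<Lambda> \<mu> \<alpha>, \<eta>) | \<alpha> \<eta>. \<alpha> \<in> E \<and> (cmp \<Lambda> \<mu> \<alpha>, \<eta>) \<in> ds_pairs \<Lambda>} \<subseteq> {y. \<omega>.gap \<mu> E * y = 0}"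
    using \<omega>.gap_kill[OF \<mu> E(1,2)]
    by (intro \<omega>.rep_span_subsetI) (auto simp: subspace_def distrib_left mult_scaleC_right)
  then have "\<omega>.gap \<mu> E * (c *\<^sub>C \<omega> \<mu> \<nu> + \<omega> \<mu> \<mu> * b') = c *\<^sub>C (\<omega>.gap \<mu> E * \<omega> \<mu> \<nu>)"
    using E(4) by (auto simp: distrib_left mult_scaleC_right)
  then have "\<rho> (c *\<^sub>C (\<omega>.gap \<mu> E * \<omega> \<mu> \<nu>)) = 0"
    using corner0 by (metis hom_mult mult_zero_right)
  then have "c *\<^sub>C (\<tau>.gap \<mu> E * \<tau> \<mu> \<nu>) = 0"
    by (simp add: hom_scaleC hom_mult hom_gap[OF \<mu> E(1,2)] hom_rep[OF ds(1)])
  then have gap0: "\<tau>.gap \<mu> E = 0"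
    by (rule zero[OF _ \<tau>.gap_absorb_right[OF \<mu> E(1) \<open>E \<noteq> {}\<close> E(2)]])
  have "exhaustive G P \<Lambda> (src \<Lambda> \<mu>) E"
    using \<tau>.exhaustive_if_gap_eq_0[OF nonzero \<mu> E(1) \<open>E \<noteq> {}\<close> E(2) gap0] .
  then have "\<omega>.gap \<mu> E \<in> vanishing_gaps"
    using \<mu> E(1) gap0 unfolding vanishing_gaps_def by blast
  then have "\<omega>.gap \<mu> E * \<omega> \<mu> \<nu> \<in> gap_ideal"
    using closed_ideal_generated_superset by (blast intro: gap_ideal(5))
  moreover have "\<omega> \<mu> \<nu> - \<omega>.gap \<mu> E * \<omega> \<mu> \<nu> \<in> \<omega>.core (D - {p})"
    using \<omega>.gap_mult_rep[OF D ds(1) deg(1) E(1) \<open>E \<noteq> {}\<close> E(2,3)]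
      subspace_neg[OF \<omega>.subspace_rep_span] by (metis minus_diff_eq)
  ultimately show thesis using that by blast
qed

text \<open>
  Induction on the set of degrees, and for a minimal degree \<open>p\<close> on the set of generators of degree
  \<open>p\<close> that occur: each of them is traded, modulo the ideal, for an element of the remaining degrees.
\<close>
lemma kernel_core_subset_gap_ideal:
  assumes "finite D" "join_closed G P D" "a \<in> \<omega>.core D" "\<rho> a = 0"
  shows "a \<in> gap_ideal"
  using assms
proof (induction D arbitrary: a rule: finite_psubset_induct)
  case (psubset D)
  have DP: "D \<subseteq> P" using psubset.prems(1) unfolding join_closed_def by blast
  show ?case
  proof (cases "D = {}")
    case True
    then have "a = 0" using psubset.prems(2) by (simp add: \<omega>.rep_span_def \<omega>.pairs_of_degree_def)
    then show ?thesis by (simp add: gap_ideal(2))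
  next
    case False
    then obtain p where p: "p \<in> D" "\<And>q. q \<in> D \<Longrightarrow> qlo_le G P q p \<Longrightarrow> q = p"
      using \<omega>.ex_minimal psubset.hyps DP by metis
    have D': "join_closed G P (D - {p})" "D - {p} \<subset> D"
      using \<omega>.join_closed_remove_minimal[OF psubset.prems(1) p(2)] p(1) by auto
    have claim: "x + b \<in> gap_ideal"
      if "finite S" "S \<subseteq> \<omega>.pairs_of_degree {p}" "x \<in> \<omega>.rep_span S" "b \<in> \<omega>.core (D - {p})" "\<rho> (x + b) = 0"
      for S x b
      using that
    proof (induction S arbitrary: x b)
      case empty
      then have "x = 0" by (simp add: \<omega>.rep_span_def)
      then show ?case using psubset.IH[OF D'(2,1)] empty by simp
    next
      case (insert s S)
      obtain \<mu> \<nu> where s: "s = (\<mu>, \<nu>)" by (cases s)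
      obtain c y where y: "y \<in> \<omega>.rep_span S" "x = c *\<^sub>C \<omega> \<mu> \<nu> + y"
        using insert.prems(2) \<omega>.rep_span_insert unfolding s by blast
      show ?case
      proof (cases "c = 0")
        case True
        then show ?thesis using insert.IH[of y b] insert.prems y by simp
      next
        case False
        have "(\<mu>, \<nu>) \<in> \<omega>.pairs_of_degree {p}" "S \<subseteq> \<omega>.pairs_of_degree {p}" "(\<mu>, \<nu>) \<notin> S"
          "\<rho> (c *\<^sub>C \<omega> \<mu> \<nu> + y + b) = 0"
          using insert.prems insert.hyps y by (auto simp: s)
        then obtain i where i: "i \<in> gap_ideal" "\<omega> \<mu> \<nu> - i \<in> \<omega>.core (D - {p})"
          using minimal_unit_congruent_core[OF psubset.prems(1) p(2,1) _ _ _ y(1) insert.prems(3) False]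
          by blast
        define b' where "b' = c *\<^sub>C (\<omega> \<mu> \<nu> - i) + b"
        have eq: "x + b = c *\<^sub>C i + (y + b')"
          by (simp add: y(2) b'_def scaleC_diff_right)
        have "b' \<in> \<omega>.core (D - {p})"
          unfolding b'_def using i(2) insert.prems(3) by (intro \<omega>.rep_span_add \<omega>.scaleC_rep_span)
        moreover have "\<rho> (y + b') = 0"
          using insert.prems(4) hom_gap_ideal[OF i(1)] unfolding eq by (simp add: hom_add hom_scaleC)
        ultimately have "y + b' \<in> gap_ideal"
          using insert.IH[of y b'] insert.prems(1) y(1) by blast
        then show ?thesis unfolding eq by (rule gap_ideal(3)[OF gap_ideal(4)[OF i(1)]])
      qed
    qed
    obtain x b where xb: "x \<in> \<omega>.core {p}" "b \<in> \<omega>.core (D - {p})" "a = x + b"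
      using \<omega>.core_split[OF psubset.prems(2) p(1)] .
    obtain S where "finite S" "S \<subseteq> \<omega>.pairs_of_degree {p}" "x \<in> \<omega>.rep_span S"
      using \<omega>.rep_span_finite[OF xb(1)] .
    then show ?thesis using claim xb psubset.prems(3) by simp
  qed
qed

text \<open>
  A kernel element \<open>x\<close> is close to some \<open>a\<close> in the span of finitely many degrees.  Then
  \<open>\<parallel>\<rho> a\<parallel> \<le> \<parallel>a - x\<parallel>\<close> is small, so \<open>ex_kernel_approximation\<close> gives a kernel element \<open>k\<close> of this span close
  to \<open>a\<close>; and \<open>k\<close> lies in the ideal.
\<close>
lemma kernel_eq_gap_ideal:
  assumes dense: "closure (\<omega>.rep_span (ds_pairs \<Lambda>)) = UNIV"
  shows "{x. \<rho> x = 0} = gap_ideal"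
proof
  show "gap_ideal \<subseteq> {x. \<rho> x = 0}" using hom_gap_ideal by blast
  show "{x. \<rho> x = 0} \<subseteq> gap_ideal"
  proof
    fix x assume "x \<in> {x. \<rho> x = 0}"
    then have x: "\<rho> x = 0" by simp
    have "x \<in> closure gap_ideal"
      unfolding closure_approachable
    proof (intro allI impI)
      fix e :: real assume e: "e > 0"
      obtain a where a: "a \<in> \<omega>.rep_span (ds_pairs \<Lambda>)" "dist a x < e / 2"
        using dense e closure_approachable[of x "\<omega>.rep_span (ds_pairs \<Lambda>)"] by (metis UNIV_I half_gt_zero)
      obtain S where S: "finite S" "S \<subseteq> ds_pairs \<Lambda>" "a \<in> \<omega>.rep_span S"
        using \<omega>.rep_span_finite[OF a(1)] .
      have "(\<lambda>(\<mu>, \<nu>). deg \<Lambda> \<mu>) ` S \<subseteq> P"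
        using S(2) by (auto simp: \<omega>.ds_pairs_iff \<omega>.deg_closed)
      then obtain D where D: "finite D" "(\<lambda>(\<mu>, \<nu>). deg \<Lambda> \<mu>) ` S \<subseteq> D" "join_closed G P D"
        using \<omega>.ex_finite_join_closed S(1) by (metis finite_imageI)
      have "S \<subseteq> \<omega>.pairs_of_degree D" using S(2) D(2) by (auto simp: \<omega>.pairs_of_degree_def)
      then have "a \<in> \<omega>.core D" using S(3) \<omega>.rep_span_mono by blast
      then obtain A Y where A: "star_subalgebra A" "a \<in> A" "A \<subseteq> \<omega>.core D" "A \<subseteq> span Y" "finite Y"
        using \<omega>.finite_dimensional_star_subalgebra[OF D(1,3)] by blast
      obtain k where k: "k \<in> A" "\<rho> k = 0" "norm (a - k) \<le> norm (\<rho> a)"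
        using ex_kernel_approximation[OF A(1,4,5,2)] .
      have "k \<in> gap_ideal"
        using kernel_core_subset_gap_ideal[OF D(1,3)] k A(3) by blast
      moreover have "norm (\<rho> a) \<le> norm (a - x)"
        using norm_hom_le[of "a - x"] x by (simp add: hom_diff)
      then have "dist k x < e"
        using k(3) a(2) norm_triangle_ineq4[of "a - x" "a - k"] by (simp add: dist_norm)
      ultimately show "\<exists>y\<in>gap_ideal. dist y x < e" by blast
    qed
    then show "x \<in> gap_ideal" using gap_ideal(1) by simp
  qed
qed

end


section \<open>Density of the span of the generators\<close>

lemma (in aligned_representation) closure_rep_span_if_generating:
  assumes gen: "cstar_generated type_cstar ((\<lambda>(\<mu>, \<nu>). \<tau> \<mu> \<nu>) ` ds_pairs \<Lambda>) = UNIV"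
  shows "closure (rep_span (ds_pairs \<Lambda>)) = UNIV"
proof -
  let ?V = "rep_span (ds_pairs \<Lambda>)"
  have "ds_pairs \<Lambda> = pairs_of_degree P"
    using deg_closed unfolding pairs_of_degree_def ds_pairs_def by blast
  then have V: "?V = core P"
    by simp
  have mult: "x * y \<in> ?V" if "x \<in> ?V" "y \<in> ?V" for x y
    using that unfolding V by (rule mult_core[rotated]) (simp add: is_join_def)
  have "x + y \<in> closure ?V \<and> x * y \<in> closure ?V" if xy: "x \<in> closure ?V" "y \<in> closure ?V" for x y
  proof -
    obtain f g where f: "\<And>n. f n \<in> ?V" "f \<longlonglongrightarrow> x" and g: "\<And>n. g n \<in> ?V" "g \<longlonglongrightarrow> y"
      using xy unfolding closure_sequential by blast
    have "f n + g n \<in> ?V" "f n * g n \<in> ?V" for n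
      using f(1) g(1) by (auto intro: mult rep_span_add)
    moreover have "(\<lambda>n. f n + g n) \<longlonglongrightarrow> x + y" "(\<lambda>n. f n * g n) \<longlonglongrightarrow> x * y"
      using f(2) g(2) by (rule tendsto_add, rule tendsto_mult)
    ultimately show ?thesis
      unfolding closure_sequential by (intro conjI exI[of _ "\<lambda>n. f n + g n"] exI[of _ "\<lambda>n. f n * g n"]) auto
  qed
  moreover have "h x \<in> closure ?V" if "x \<in> closure ?V" "bounded_linear h" "\<And>x. x \<in> ?V \<Longrightarrow> h x \<in> ?V"
    for x and h :: "'a \<Rightarrow> 'a"
  proof -
    have "h ` closure ?V \<subseteq> closure (h ` ?V)"
      by (rule closure_bounded_linear_image_subset[OF that(2)])
    also have "\<dots> \<subseteq> closure ?V" using that(3) by (intro closure_mono) blast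
    finally show ?thesis using that(1) by blast
  qed
  then have "c *\<^sub>C x \<in> closure ?V \<and> adj x \<in> closure ?V" if "x \<in> closure ?V" for c x
    using that bounded_linear_scaleC bounded_linear_adj scaleC_rep_span adj_core unfolding V by metis
  moreover have "x \<in> closure ?V"
    if "\<forall>n. f n \<in> closure ?V" "(\<lambda>n. norm (f n - x)) \<longlonglongrightarrow> 0" for f x
    using that closed_sequentially[OF closed_closure, of f ?V x]
    by (simp add: tendsto_norm_zero_iff LIM_zero_iff)
  moreover have "0 \<in> closure ?V" using rep_span_zero closure_subset by blast
  ultimately have "cstar_subalgebra type_cstar (closure ?V)"
    unfolding cstar_subalgebra_def by auto
  moreover have "(\<lambda>(\<mu>, \<nu>). \<tau> \<mu> \<nu>) ` ds_pairs \<Lambda> \<subseteq> closure ?V"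
    using rep_span_base1 closure_subset by fastforce
  ultimately have "cstar_generated type_cstar ((\<lambda>(\<mu>, \<nu>). \<tau> \<mu> \<nu>) ` ds_pairs \<Lambda>) \<subseteq> closure ?V"
    unfolding cstar_generated_def by blast
  with gen show ?thesis by blast
qed

theorem theorem4p9:
  fixes G :: "('g, 'x) monoid_scheme" and P :: "'g set"
    and \<Lambda> :: "('m, 'g) graph_data"
    and \<omega> :: "'m \<Rightarrow> 'm \<Rightarrow> 'u::cstar_algebra"
    and \<tau> :: "'m \<Rightarrow> 'm \<Rightarrow> 'b::cstar_algebra"
    and \<rho> :: "'u \<Rightarrow> 'b"
  assumes "quasi_lattice_ordered_group G P"
    and "P_graph G P \<Lambda>"
    and "finitely_aligned G P \<Lambda>"
    and "universal_representation G P \<Lambda> type_cstar \<omega>"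
    and "ds_representation G P \<Lambda> type_cstar \<tau>"
    and "\<And>\<mu>. \<mu> \<in> Mor \<Lambda> \<Longrightarrow> \<tau> \<mu> \<mu> \<noteq> 0"
    and "induced_hom \<Lambda> type_cstar \<omega> type_cstar \<tau> \<rho>"
  shows "{x. \<rho> x = 0} = closed_ideal_generated
    (\<Union>\<mu>\<in>Mor \<Lambda>. {commuting_prod (\<lambda>\<alpha>. \<omega> \<mu> \<mu> - \<omega> (cmp \<Lambda> \<mu> \<alpha>) (cmp \<Lambda> \<mu> \<alpha>)) E | E.
       finite E \<and> exhaustive G P \<Lambda> (src \<Lambda> \<mu>) E \<and>
       commuting_prod (\<lambda>\<alpha>. \<tau> \<mu> \<mu> - \<tau> (cmp \<Lambda> \<mu> \<alpha>) (cmp \<Lambda> \<mu> \<alpha>)) E = 0})"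
proof -
  have \<omega>: "ds_representation G P \<Lambda> type_cstar \<omega>"
    and gen: "cstar_generated type_cstar ((\<lambda>(\<mu>, \<nu>). \<omega> \<mu> \<nu>) ` ds_pairs \<Lambda>) = UNIV"
    using assms(4) by (simp_all add: universal_representation_def rep_algebra_def)
  have aligned_\<omega>: "aligned_representation G P \<Lambda> \<omega>"
    using assms(2,3) \<omega> by (simp add: aligned_representation_def aligned_representation_axioms_def)
  have aligned_\<tau>: "aligned_representation G P \<Lambda> \<tau>"
    using assms(2,3,5) by (simp add: aligned_representation_def aligned_representation_axioms_def)
  have "star_hom \<rho>"
    using assms(7)
    by unfold_locales (simp_all add: induced_hom_def cstar_hom_def rep_algebra_def type_cstar_def)
  moreover have "\<rho> (\<omega> \<mu> \<nu>) = \<tau> \<mu> \<nu>" if "(\<mu>, \<nu>) \<in> ds_pairs \<Lambda>" for \<mu> \<nu>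
    using assms(7) that by (auto simp: induced_hom_def)
  ultimately interpret representation_comparison G P \<Lambda> \<omega> \<tau> \<rho>
    using aligned_\<omega> aligned_\<tau> assms(6)
    by (intro representation_comparison.intro representation_comparison_axioms.intro)
  show ?thesis
    using kernel_eq_gap_ideal[OF \<omega>.closure_rep_span_if_generating[OF gen]]
    by (simp add: vanishing_gaps_def \<omega>.gap_def \<tau>.gap_def)
qed

end
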